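(* Let $(\mathcal O,\mathcal C,\mathbf 2_{\mathcal C},\iota)$ be an SFC-category. Consider the adjunctions $\mathsf{pt}_{\mathcal C}\dashv\Omega_{\mathcal C}$ (between $\mathcal C$ and $\mathbf{Top}_{\mathcal C}^{\mathrm{op}}$) and $\mathsf{pt}\dashv\Omega$ (between $\mathbf{Frm}$ and $\mathbf{Top}^{\mathrm{op}}$), the functor $\mathcal O:\mathcal C\to\mathbf{Frm}$ and the inclusion $\mathbf{Top}_{\mathcal C}^{\mathrm{op}}\hookrightarrow\mathbf{Top}^{\mathrm{op}}$. For $X\in\mathbf{Top}_{\mathcal C}$ let $\zeta_X:\mathcal O\Omega_{\mathcal C}X\to\Omega X$ be the frame map with underlying function $\theta_X$, and for $C\in\mathcal C$ let $\xi_C:\mathsf{pt}_{\mathcal C}C\to\mathsf{pt}\,\mathcal OC$ be the continuous map $f\mapsto\iota\circ\mathcal Of$. Then these two functors together with the natural transformations $\zeta$ and $\xi$ constitute a right adjunction morphism from $\mathsf{pt}_{\mathcal C}\dashv\Omega_{\mathcal C}$ to $\mathsf{pt}\dashv\Omega$.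
   Context: $\mathbf{Frm}$ is the category of frames and frame homomorphisms, $\mathbf 2=\{0<1\}$, $\mathbf{Top}$ the category of topological spaces, $\mathbb S$ the Sierpinski space ($\{0,1\}$ with opens $\emptyset,\{1\},\{0,1\}$); $|\cdot|$ denotes underlying sets and functions. $\mathbf{Top}(X,\mathbb S)$ is identified with the frame $\Omega(X)$ of opens. $\mathsf{pt}\dashv\Omega$ is the classical adjunction: $\mathsf{pt}(L)=\mathbf{Frm}(L,\mathbf 2)$ with opens $\{f\mid f(a)=1\}$, $a\in L$. Lifts. Let $U:\mathcal A\to\mathcal B$ be a faithful functor. A morphism $f:U(A)\to U(A')$ lifts if $f=U(p)$ for a (unique) $p$, its lift. A cartesian lift w.r.t. $U$ of a family $\{f_i:X\to U(C)\}$ is a pair $(\overline X,\theta)$, $\overline X\in\mathcal A$, $\theta:U(\overline X)\to X$ an isomorphism, such that for every $D$ a morphism $h:U(D)\to U(\overline X)$ lifts iff every $f_i\theta h$ lifts. A PFC-category is a quadruple $(\mathcal O,\mathcal C,\mathbf 2_{\mathcal C},\iota)$ with $\mathcal O:\mathcal C\to\mathbf{Frm}$ faithful, $\mathbf 2_{\mathcal C}\in\mathcal C$, $\iota:\mathcal O(\mathbf 2_{\mathcal C})\to\mathbf 2$ an isomorphism. $\mathbf{Top}_{\mathcal C}$ is the full subcategory of $\mathbf{Top}$ of spaces $X$ for which the family $\{|\iota^{-1}|\circ\chi_x:\mathbf{Top}(X,\mathbb S)\to|\mathcal O(\mathbf 2_{\mathcal C})|\mid x\in X\}$, $\chi_x(g)=g(x)$,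 has a cartesian lift $(\Omega_{\mathcal C}X,\theta_X)$ w.r.t. $|\mathcal O(-)|:\mathcal C\to\mathbf{Set}$; $\overline{\chi_x}:\Omega_{\mathcal C}X\to\mathbf 2_{\mathcal C}$ is the lift of $|\iota^{-1}|\circ\chi_x\circ\theta_X$. $\mathsf{pt}_{\mathcal C}(C)$ is the set $\mathcal C(C,\mathbf 2_{\mathcal C})$ with opens $\{f\mid\iota(\mathcal Of(a))=1\}$, $a\in\mathcal O(C)$. It is an SFC-category if $\mathbb S\in\mathbf{Top}_{\mathcal C}$ and $\mathsf{pt}_{\mathcal C}(C)\in\mathbf{Top}_{\mathcal C}$ for all $C$. Then there is an adjunction $\mathsf{pt}_{\mathcal C}\dashv\Omega_{\mathcal C}$, $\mathsf{pt}_{\mathcal C}:\mathcal C\to\mathbf{Top}_{\mathcal C}^{\mathrm{op}}$ acting by precomposition, $\Omega_{\mathcal C}$ sending $f:X\to Y$ to the lift of $\theta_X^{-1}\circ(-\circ f)\circ\theta_Y$, with units $\sigma^{\mathcal C}_X:x\mapsto\overline{\chi_x}$ and $\eta^{\mathcal C}_C:C\to\Omega_{\mathcal C}\mathsf{pt}_{\mathcal C}C$ determined by $\theta_{\mathsf{pt}_{\mathcal C}C}\circ|\mathcal O\eta^{\mathcal C}_C|(a)=(f\mapsto\iota(\mathcal Of(a)))$. Right adjunction morphisms. Given adjunctions $F\dashv G$ ($F:\mathcal A\to\mathcal B$, unit $\eta$) and $P\dashv Q$ ($P:\mathcal C'\to\mathcal D'$, counit $\delta$) and functors $U:\mathcal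 A\to\mathcal C'$, $V:\mathcal B\to\mathcal D'$, natural transformations $\zeta:UG\to QV$ and $\xi:PU\to VF$ are a mate-pair if $\xi=\delta_{VF}\circ P\zeta_F\circ PU\eta$. The data $(U,V,\zeta,\xi)$ is a right adjunction morphism if $\zeta,\xi$ are a mate-pair and $\zeta$ is invertible. (Here $\xi$ is a natural transformation in $\mathbf{Top}^{\mathrm{op}}$, so its components are continuous maps $\mathsf{pt}_{\mathcal C}C\to\mathsf{pt}\,\mathcal OC$.) *)

theory Defs
  imports "HOL-Analysis.Abstract_Topology" "HOL-Algebra.Complete_Lattice"
begin

section \<open>Categories, functors and natural transformations\<close>

record ('o, 'm) cat =
  Ob :: "'o set"
  Arr :: "'m set"
  Dom :: "'m \<Rightarrow> 'o"
  Cod :: "'m \<Rightarrow> 'o"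
  Id :: "'o \<Rightarrow> 'm"
  Comp :: "'m \<Rightarrow> 'm \<Rightarrow> 'm"  (infixl \<open>\<circ>\<index>\<close> 70)

definition Hom :: "('o, 'm) cat \<Rightarrow> 'o \<Rightarrow> 'o \<Rightarrow> 'm set" where
  "Hom A X Y = {f \<in> Arr A. Dom A f = X \<and> Cod A f = Y}"

definition category :: "('o, 'm) cat \<Rightarrow> bool" where
  "category A \<longleftrightarrow>
     (\<forall>f\<in>Arr A. Dom A f \<in> Ob A \<and> Cod A f \<in> Ob A) \<and>
     (\<forall>X\<in>Ob A. Id A X \<in> Hom A X X) \<and>
     (\<forall>f\<in>Arr A. \<forall>g\<in>Arr A. Dom A g = Cod A f \<longrightarrow> g \<circ>\<^bsub>A\<^esub> f \<in> Hom A (Dom A f) (Cod A g)) \<and>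
     (\<forall>f\<in>Arr A. f \<circ>\<^bsub>A\<^esub> Id A (Dom A f) = f \<and> Id A (Cod A f) \<circ>\<^bsub>A\<^esub> f = f) \<and>
     (\<forall>f\<in>Arr A. \<forall>g\<in>Arr A. \<forall>h\<in>Arr A. Dom A g = Cod A f \<longrightarrow> Dom A h = Cod A g \<longrightarrow>
        h \<circ>\<^bsub>A\<^esub> (g \<circ>\<^bsub>A\<^esub> f) = (h \<circ>\<^bsub>A\<^esub> g) \<circ>\<^bsub>A\<^esub> f)"

definition op_cat :: "('o, 'm) cat \<Rightarrow> ('o, 'm) cat" where
  "op_cat A = \<lparr>Ob = Ob A, Arr = Arr A, Dom = Cod A, Cod = Dom A, Id = Id A,
               Comp = (\<lambda>g f. f \<circ>\<^bsub>A\<^esub> g)\<rparr>"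

definition full_subcat :: "('o, 'm) cat \<Rightarrow> 'o set \<Rightarrow> ('o, 'm) cat" where
  "full_subcat A S = A\<lparr>Ob := Ob A \<inter> S, Arr := {f \<in> Arr A. Dom A f \<in> S \<and> Cod A f \<in> S}\<rparr>"

definition inverse_arrs :: "('o, 'm) cat \<Rightarrow> 'm \<Rightarrow> 'm \<Rightarrow> bool" where
  "inverse_arrs A f g \<longleftrightarrow> f \<in> Arr A \<and> g \<in> Hom A (Cod A f) (Dom A f) \<and>
     g \<circ>\<^bsub>A\<^esub> f = Id A (Dom A f) \<and> f \<circ>\<^bsub>A\<^esub> g = Id A (Cod A f)"

definition iso_arr :: "('o, 'm) cat \<Rightarrow> 'm \<Rightarrow> bool" where
  "iso_arr A f \<longleftrightarrow> (\<exists>g. inverse_arrs A f g)"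

definition inv_arr :: "('o, 'm) cat \<Rightarrow> 'm \<Rightarrow> 'm" where
  "inv_arr A f = (THE g. inverse_arrs A f g)"

record ('o, 'm, 'p, 'n) ftor =
  fob :: "'o \<Rightarrow> 'p"
  farr :: "'m \<Rightarrow> 'n"

definition is_functor :: "('o, 'm) cat \<Rightarrow> ('p, 'n) cat \<Rightarrow> ('o, 'm, 'p, 'n) ftor \<Rightarrow> bool" where
  "is_functor A B F \<longleftrightarrow> category A \<and> category B \<and>
     (\<forall>X\<in>Ob A. fob F X \<in> Ob B) \<and>
     (\<forall>f\<in>Arr A. farr F f \<in> Hom B (fob F (Dom A f)) (fob F (Cod A f))) \<and>
     (\<forall>X\<in>Ob A. farr F (Id A X) = Id B (fob F X)) \<and>
     (\<forall>f\<in>Arr A. \<forall>g\<in>Arr A. Dom A g = Cod A f \<longrightarrow>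
        farr F (g \<circ>\<^bsub>A\<^esub> f) = farr F g \<circ>\<^bsub>B\<^esub> farr F f)"

definition faithful :: "('o, 'm) cat \<Rightarrow> ('o, 'm, 'p, 'n) ftor \<Rightarrow> bool" where
  "faithful A F \<longleftrightarrow> (\<forall>X\<in>Ob A. \<forall>Y\<in>Ob A. inj_on (farr F) (Hom A X Y))"

definition id_ftor :: "('o, 'm, 'o, 'm) ftor" where
  "id_ftor = \<lparr>fob = (\<lambda>X. X), farr = (\<lambda>f. f)\<rparr>"

definition comp_ftor ::
  "('p, 'n, 'q, 'k) ftor \<Rightarrow> ('o, 'm, 'p, 'n) ftor \<Rightarrow> ('o, 'm, 'q, 'k) ftor"  (infixl \<open>\<circ>\<^sub>F\<close> 70) where
  "G \<circ>\<^sub>F F = \<lparr>fob = (\<lambda>X. fob G (fob F X)), farr = (\<lambda>f. farr G (farr F f))\<rparr>"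

definition nat_trans ::
  "('o, 'm) cat \<Rightarrow> ('p, 'n) cat \<Rightarrow> ('o, 'm, 'p, 'n) ftor \<Rightarrow> ('o, 'm, 'p, 'n) ftor \<Rightarrow> ('o \<Rightarrow> 'n) \<Rightarrow> bool" where
  "nat_trans A B F G \<tau> \<longleftrightarrow> is_functor A B F \<and> is_functor A B G \<and>
     (\<forall>X\<in>Ob A. \<tau> X \<in> Hom B (fob F X) (fob G X)) \<and>
     (\<forall>f\<in>Arr A. farr G f \<circ>\<^bsub>B\<^esub> \<tau> (Dom A f) = \<tau> (Cod A f) \<circ>\<^bsub>B\<^esub> farr F f)"


section \<open>Adjunctions and right adjunction morphisms\<close>

record ('a, 'm, 'b, 'n) adj =
  lcat :: "('a, 'm) cat"
  rcat :: "('b, 'n) cat"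
  ladj :: "('a, 'm, 'b, 'n) ftor"
  radj :: "('b, 'n, 'a, 'm) ftor"
  aunit :: "'a \<Rightarrow> 'm"
  acounit :: "'b \<Rightarrow> 'n"

definition adjunction :: "('a, 'm, 'b, 'n) adj \<Rightarrow> bool" where
  "adjunction J \<longleftrightarrow>
     (let A = lcat J; B = rcat J; F = ladj J; G = radj J; \<eta> = aunit J; \<epsilon> = acounit J in
        is_functor A B F \<and> is_functor B A G \<and>
        nat_trans A A id_ftor (G \<circ>\<^sub>F F) \<eta> \<and> nat_trans B B (F \<circ>\<^sub>F G) id_ftor \<epsilon> \<and>
        (\<forall>X\<in>Ob A. \<epsilon> (fob F X) \<circ>\<^bsub>B\<^esub> farr F (\<eta> X) = Id B (fob F X)) \<and>
        (\<forall>Y\<in>Ob B. farr G (\<epsilon> Y) \<circ>\<^bsub>A\<^esub> \<eta> (fob G Y) = Id A (fob G Y)))"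

definition mate_pair ::
  "('a, 'm, 'b, 'n) adj \<Rightarrow> ('c, 'k, 'd, 'l) adj \<Rightarrow> ('a, 'm, 'c, 'k) ftor \<Rightarrow> ('b, 'n, 'd, 'l) ftor \<Rightarrow>
   ('b \<Rightarrow> 'k) \<Rightarrow> ('a \<Rightarrow> 'l) \<Rightarrow> bool" where
  "mate_pair J K U V \<zeta> \<xi> \<longleftrightarrow>
     (let A = lcat J; B = rcat J; F = ladj J; G = radj J; \<eta> = aunit J;
          C = lcat K; D = rcat K; P = ladj K; Q = radj K; \<delta> = acounit K in
        nat_trans B C (U \<circ>\<^sub>F G) (Q \<circ>\<^sub>F V) \<zeta> \<and>
        nat_trans A D (P \<circ>\<^sub>F U) (V \<circ>\<^sub>F F) \<xi> \<and>
        (\<forall>X\<in>Ob A. \<xi> X =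
           \<delta> (fob V (fob F X)) \<circ>\<^bsub>D\<^esub> farr P (\<zeta> (fob F X)) \<circ>\<^bsub>D\<^esub> farr P (farr U (\<eta> X))))"

definition right_adjunction_morphism ::
  "('a, 'm, 'b, 'n) adj \<Rightarrow> ('c, 'k, 'd, 'l) adj \<Rightarrow> ('a, 'm, 'c, 'k) ftor \<Rightarrow> ('b, 'n, 'd, 'l) ftor \<Rightarrow>
   ('b \<Rightarrow> 'k) \<Rightarrow> ('a \<Rightarrow> 'l) \<Rightarrow> bool" where
  "right_adjunction_morphism J K U V \<zeta> \<xi> \<longleftrightarrow>
     adjunction J \<and> adjunction K \<and>
     is_functor (lcat J) (lcat K) U \<and> is_functor (rcat J) (rcat K) V \<and>
     mate_pair J K U V \<zeta> \<xi> \<and> (\<forall>Y\<in>Ob (rcat J). iso_arr (lcat K) (\<zeta> Y))"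


section \<open>Lifts\<close>

definition is_lift :: "('a, 'm) cat \<Rightarrow> ('a, 'm, 'b, 'n) ftor \<Rightarrow> 'a \<Rightarrow> 'a \<Rightarrow> 'n \<Rightarrow> 'm \<Rightarrow> bool" where
  "is_lift A U X X' f p \<longleftrightarrow> p \<in> Hom A X X' \<and> farr U p = f"

definition lifts :: "('a, 'm) cat \<Rightarrow> ('a, 'm, 'b, 'n) ftor \<Rightarrow> 'a \<Rightarrow> 'a \<Rightarrow> 'n \<Rightarrow> bool" where
  "lifts A U X X' f \<longleftrightarrow> (\<exists>p. is_lift A U X X' f p)"

definition the_lift :: "('a, 'm) cat \<Rightarrow> ('a, 'm, 'b, 'n) ftor \<Rightarrow> 'a \<Rightarrow> 'a \<Rightarrow> 'n \<Rightarrow> 'm" where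
  "the_lift A U X X' f = (THE p. is_lift A U X X' f p)"

definition cartesian_lift ::
  "('a, 'm) cat \<Rightarrow> ('b, 'n) cat \<Rightarrow> ('a, 'm, 'b, 'n) ftor \<Rightarrow> 'b \<Rightarrow> 'a \<Rightarrow> 'i set \<Rightarrow> ('i \<Rightarrow> 'n) \<Rightarrow>
   'a \<Rightarrow> 'n \<Rightarrow> bool" where
  "cartesian_lift A B U X C I f Xbar \<theta> \<longleftrightarrow>
     Xbar \<in> Ob A \<and> \<theta> \<in> Hom B (fob U Xbar) X \<and> iso_arr B \<theta> \<and>
     (\<forall>D\<in>Ob A. \<forall>h\<in>Hom B (fob U D) (fob U Xbar).
        lifts A U D Xbar h \<longleftrightarrow> (\<forall>i\<in>I. lifts A U D C (f i \<circ>\<^bsub>B\<^esub> \<theta> \<circ>\<^bsub>B\<^esub> h)))"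


section \<open>Concrete categories of sets with structure\<close>

text \<open>An arrow is a function together with its source and target; the function is
  \<^const>\<open>undefined\<close> outside the underlying set of the source, so that arrows with equal
  values are equal.\<close>

datatype ('o, 'u) arrow = Arrow (src: 'o) (fn: "'u \<Rightarrow> 'u") (tgt: 'o)

definition concrete_cat ::
  "'o set \<Rightarrow> ('o \<Rightarrow> 'u set) \<Rightarrow> ('o \<Rightarrow> 'o \<Rightarrow> ('u \<Rightarrow> 'u) \<Rightarrow> bool) \<Rightarrow> ('o, ('o, 'u) arrow) cat" where
  "concrete_cat obs car mor =
     \<lparr>Ob = obs,
      Arr = {Arrow X f Y | X f Y. X \<in> obs \<and> Y \<in> obs \<and> f \<in> car X \<rightarrow>\<^sub>E car Y \<and> mor X Y f},
      Dom = src, Cod = tgt,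
      Id = (\<lambda>X. Arrow X (\<lambda>x\<in>car X. x) X),
      Comp = (\<lambda>q p. Arrow (src p) (compose (car (src p)) (fn q) (fn p)) (tgt q))\<rparr>"

definition frame :: "'u gorder \<Rightarrow> bool" where
  "frame L \<longleftrightarrow> complete_lattice L \<and>
     (\<forall>a\<in>carrier L. \<forall>S\<subseteq>carrier L. a \<sqinter>\<^bsub>L\<^esub> (\<Squnion>\<^bsub>L\<^esub> S) = \<Squnion>\<^bsub>L\<^esub> ((\<lambda>s. a \<sqinter>\<^bsub>L\<^esub> s) ` S))"

definition frame_hom :: "'u gorder \<Rightarrow> 'u gorder \<Rightarrow> ('u \<Rightarrow> 'u) \<Rightarrow> bool" where
  "frame_hom L M f \<longleftrightarrow> f \<in> carrier L \<rightarrow> carrier M \<and>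
     (\<forall>S\<subseteq>carrier L. f (\<Squnion>\<^bsub>L\<^esub> S) = \<Squnion>\<^bsub>M\<^esub> (f ` S)) \<and>
     f (\<top>\<^bsub>L\<^esub>) = \<top>\<^bsub>M\<^esub> \<and>
     (\<forall>a\<in>carrier L. \<forall>b\<in>carrier L. f (a \<sqinter>\<^bsub>L\<^esub> b) = f a \<sqinter>\<^bsub>M\<^esub> f b)"

text \<open>A PFC-category is a quadruple. The arrows of the domain category are elements of the
  universe of sets \<open>'u\<close> (so that hom-sets can carry topologies); its objects
  are arbitrary, so it need not be small.\<close>

record ('o, 'u) pfc =
  Ofun :: "('o, 'u, 'u gorder, ('u gorder, 'u) arrow) ftor"
  Ccat :: "('o, 'u) cat"
  two_C :: 'o
  \<iota> :: "('u gorder, 'u) arrow"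

text \<open>Frames, spaces, power sets and hom-sets have to live at a common type, which no HOL type
  can provide for all its subsets. So sets are the elements of a universe: a type \<open>'u\<close>
  in which every \<open>a\<close> is (determined by) the small set \<^term>\<open>elts a\<close>, closed under the usual
  operations, with replacement for arbitrary functions. Neither infinity nor foundation is
  needed.\<close>

locale universe =
  fixes elts :: "'u \<Rightarrow> 'u set"
  assumes elts_inject: "inj elts"
    and separation: "B \<subseteq> elts a \<Longrightarrow> B \<in> range elts"
    and replacement: "f ` elts a \<in> range elts"
    and union: "(\<Union>x\<in>elts a. elts x) \<in> range elts"
    and power: "{x. elts x \<subseteq> elts a} \<in> range elts"
begin

definition small :: "'u set \<Rightarrow> bool" where
  "small A \<longleftrightarrow> A \<in> range elts"

definition set_of :: "'u set \<Rightarrow> 'u" where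
  "set_of = the_inv elts"

definition kpair :: "'u \<Rightarrow> 'u \<Rightarrow> 'u" where
  "kpair x y = set_of {set_of {x}, set_of {x, y}}"

definition zero :: 'u where "zero = set_of {}"

definition one :: 'u where "one = set_of {zero}"

definition SetC :: "('u set, ('u set, 'u) arrow) cat" where
  "SetC = concrete_cat {A. small A} (\<lambda>A. A) (\<lambda>A B f. True)"

definition Frm :: "('u gorder, ('u gorder, 'u) arrow) cat" where
  "Frm = concrete_cat {L. frame L \<and> small (carrier L)} carrier frame_hom"

definition Top :: "('u topology, ('u topology, 'u) arrow) cat" where
  "Top = concrete_cat {X. small (topspace X)} topspace continuous_map"

definition und :: "('u gorder, ('u gorder, 'u) arrow, 'u set, ('u set, 'u) arrow) ftor" where
  "und = \<lparr>fob = carrier, farr = (\<lambda>p. Arrow (carrier (src p)) (fn p) (carrier (tgt p)))\<rparr>"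

definition Two :: "'u gorder" where
  "Two = \<lparr>carrier = {zero, one}, eq = (=), le = (\<lambda>x y. x = y \<or> x = zero \<and> y = one)\<rparr>"

definition Sier :: "'u topology" where
  "Sier = topology (\<lambda>U. U \<in> {{}, {one}, {zero, one}})"


subsection \<open>The classical adjunction between frames and spaces\<close>

definition Opens :: "'u topology \<Rightarrow> 'u gorder" where
  "Opens X = \<lparr>carrier = set_of ` {U. openin X U}, eq = (=), le = (\<lambda>a b. elts a \<subseteq> elts b)\<rparr>"

definition Omega ::
  "('u topology, ('u topology, 'u) arrow, 'u gorder, ('u gorder, 'u) arrow) ftor" where
  "Omega = \<lparr>fob = Opens,
     farr = (\<lambda>f. Arrow (Opens (tgt f))
                   (\<lambda>a\<in>carrier (Opens (tgt f)). set_of {x \<in> topspace (src f). fn f x \<in> elts a})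
                   (Opens (src f)))\<rparr>"

text \<open>The points of \<open>pt L\<close> are the frame maps \<open>L \<rightarrow> 2\<close>, made elements of \<open>'u\<close> by taking graphs.\<close>

definition graph :: "('u gorder, 'u) arrow \<Rightarrow> 'u" where
  "graph p = set_of ((\<lambda>a. kpair a (fn p a)) ` carrier (src p))"

definition of_graph :: "'u gorder \<Rightarrow> 'u \<Rightarrow> ('u gorder, 'u) arrow" where
  "of_graph L = the_inv_into (Hom Frm L Two) graph"

definition pt_ob :: "'u gorder \<Rightarrow> 'u topology" where
  "pt_ob L = topology (\<lambda>V. \<exists>a\<in>carrier L. V = graph ` {p \<in> Hom Frm L Two. fn p a = one})"

definition pt ::
  "('u gorder, ('u gorder, 'u) arrow, 'u topology, ('u topology, 'u) arrow) ftor" where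
  "pt = \<lparr>fob = pt_ob,
     farr = (\<lambda>h. Arrow (pt_ob (tgt h))
                   (\<lambda>u\<in>topspace (pt_ob (tgt h)). graph (of_graph (tgt h) u \<circ>\<^bsub>Frm\<^esub> h))
                   (pt_ob (src h)))\<rparr>"

definition pt_unit :: "'u gorder \<Rightarrow> ('u gorder, 'u) arrow" where
  "pt_unit L = Arrow L
     (\<lambda>a\<in>carrier L. set_of (graph ` {p \<in> Hom Frm L Two. fn p a = one})) (Opens (pt_ob L))"

text \<open>The characteristic function of \<open>x\<close>: with maps \<open>X \<rightarrow> S\<close> identified with
  open sets, \<open>g \<mapsto> g(x)\<close> sends an open set to \<open>1\<close> iff it contains \<open>x\<close>.\<close>

definition chi_fun :: "'u topology \<Rightarrow> 'u \<Rightarrow> 'u \<Rightarrow> 'u" where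
  "chi_fun X x = (\<lambda>a\<in>carrier (Opens X). if x \<in> elts a then one else zero)"

text \<open>The spaces form the opposite category in both adjunctions: the counits at \<open>X\<close>
  (\<open>pt_counit\<close> here, \<open>sigmaC\<close> below) are continuous maps out of \<open>X\<close>.\<close>

definition pt_counit :: "'u topology \<Rightarrow> ('u topology, 'u) arrow" where
  "pt_counit X = Arrow X
     (\<lambda>x\<in>topspace X. graph (Arrow (Opens X) (chi_fun X x) Two)) (pt_ob (Opens X))"

definition classical_adj ::
  "('u gorder, ('u gorder, 'u) arrow, 'u topology, ('u topology, 'u) arrow) adj" where
  "classical_adj = \<lparr>lcat = Frm, rcat = op_cat Top, ladj = pt, radj = Omega,
                    aunit = pt_unit, acounit = pt_counit\<rparr>"


subsection \<open>PFC- and SFC-categories\<close>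

definition pfc_category :: "('o, 'u) pfc \<Rightarrow> bool" where
  "pfc_category K \<longleftrightarrow>
     is_functor (Ccat K) Frm (Ofun K) \<and> faithful (Ccat K) (Ofun K) \<and>
     two_C K \<in> Ob (Ccat K) \<and>
     \<iota> K \<in> Hom Frm (fob (Ofun K) (two_C K)) Two \<and> iso_arr Frm (\<iota> K)"

definition undO :: "('o, 'u) pfc \<Rightarrow> ('o, 'u, 'u set, ('u set, 'u) arrow) ftor" where
  "undO K = und \<circ>\<^sub>F Ofun K"

definition chi :: "'u topology \<Rightarrow> 'u \<Rightarrow> ('u set, 'u) arrow" where
  "chi X x = Arrow (carrier (Opens X)) (chi_fun X x) (carrier Two)"

definition eval_family :: "('o, 'u) pfc \<Rightarrow> 'u topology \<Rightarrow> 'u \<Rightarrow> ('u set, 'u) arrow" where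
  "eval_family K X x = farr und (inv_arr Frm (\<iota> K)) \<circ>\<^bsub>SetC\<^esub> chi X x"

definition is_eval_lift ::
  "('o, 'u) pfc \<Rightarrow> 'u topology \<Rightarrow> 'o \<Rightarrow> ('u set, 'u) arrow \<Rightarrow> bool" where
  "is_eval_lift K X Xbar \<theta> \<longleftrightarrow>
     cartesian_lift (Ccat K) SetC (undO K) (carrier (Opens X)) (two_C K)
       (topspace X) (eval_family K X) Xbar \<theta>"

definition TopC :: "('o, 'u) pfc \<Rightarrow> ('u topology, ('u topology, 'u) arrow) cat" where
  "TopC K = full_subcat Top {X. \<exists>Xbar \<theta>. is_eval_lift K X Xbar \<theta>}"

definition ev :: "('o, 'u) pfc \<Rightarrow> 'u \<Rightarrow> 'u \<Rightarrow> 'u" where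
  "ev K f a = fn (\<iota> K \<circ>\<^bsub>Frm\<^esub> farr (Ofun K) f) a"

definition ptC_ob :: "('o, 'u) pfc \<Rightarrow> 'o \<Rightarrow> 'u topology" where
  "ptC_ob K C = topology (\<lambda>V. \<exists>a\<in>carrier (fob (Ofun K) C).
     V = {f \<in> Hom (Ccat K) C (two_C K). ev K f a = one})"

definition sfc_category :: "('o, 'u) pfc \<Rightarrow> bool" where
  "sfc_category K \<longleftrightarrow> pfc_category K \<and> Sier \<in> Ob (TopC K) \<and>
     (\<forall>C\<in>Ob (Ccat K). ptC_ob K C \<in> Ob (TopC K))"

text \<open>In the remaining definitions \<open>Om\<close> and \<open>\<theta>\<close> are a choice of
  cartesian lifts for the spaces in \<^term>\<open>TopC K\<close>.\<close>

definition lift_choice ::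
  "('o, 'u) pfc \<Rightarrow> ('u topology \<Rightarrow> 'o) \<Rightarrow> ('u topology \<Rightarrow> ('u set, 'u) arrow) \<Rightarrow> bool" where
  "lift_choice K Om \<theta> \<longleftrightarrow> (\<forall>X\<in>Ob (TopC K). is_eval_lift K X (Om X) (\<theta> X))"

definition chi_bar ::
  "('o, 'u) pfc \<Rightarrow> ('u topology \<Rightarrow> 'o) \<Rightarrow> ('u topology \<Rightarrow> ('u set, 'u) arrow) \<Rightarrow>
   'u topology \<Rightarrow> 'u \<Rightarrow> 'u" where
  "chi_bar K Om \<theta> X x =
     the_lift (Ccat K) (undO K) (Om X) (two_C K) (eval_family K X x \<circ>\<^bsub>SetC\<^esub> \<theta> X)"

definition ptC :: "('o, 'u) pfc \<Rightarrow> ('o, 'u, 'u topology, ('u topology, 'u) arrow) ftor" where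
  "ptC K = \<lparr>fob = ptC_ob K,
     farr = (\<lambda>p. Arrow (ptC_ob K (Cod (Ccat K) p))
                   (\<lambda>g\<in>topspace (ptC_ob K (Cod (Ccat K) p)). g \<circ>\<^bsub>Ccat K\<^esub> p)
                   (ptC_ob K (Dom (Ccat K) p)))\<rparr>"

definition OmegaC ::
  "('o, 'u) pfc \<Rightarrow> ('u topology \<Rightarrow> 'o) \<Rightarrow> ('u topology \<Rightarrow> ('u set, 'u) arrow) \<Rightarrow>
   ('u topology, ('u topology, 'u) arrow, 'o, 'u) ftor" where
  "OmegaC K Om \<theta> = \<lparr>fob = Om,
     farr = (\<lambda>f. the_lift (Ccat K) (undO K) (Om (tgt f)) (Om (src f))
       (inv_arr SetC (\<theta> (src f)) \<circ>\<^bsub>SetC\<^esub> farr und (farr Omega f) \<circ>\<^bsub>SetC\<^esub> \<theta> (tgt f)))\<rparr>"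

definition etaC ::
  "('o, 'u) pfc \<Rightarrow> ('u topology \<Rightarrow> 'o) \<Rightarrow> ('u topology \<Rightarrow> ('u set, 'u) arrow) \<Rightarrow> 'o \<Rightarrow> 'u" where
  "etaC K Om \<theta> C = (THE e. e \<in> Hom (Ccat K) C (Om (ptC_ob K C)) \<and>
     (\<forall>a\<in>carrier (fob (Ofun K) C).
        fn (\<theta> (ptC_ob K C) \<circ>\<^bsub>SetC\<^esub> farr (undO K) e) a =
        set_of {f \<in> Hom (Ccat K) C (two_C K). ev K f a = one}))"

definition sigmaC ::
  "('o, 'u) pfc \<Rightarrow> ('u topology \<Rightarrow> 'o) \<Rightarrow> ('u topology \<Rightarrow> ('u set, 'u) arrow) \<Rightarrow>
   'u topology \<Rightarrow> ('u topology, 'u) arrow" where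
  "sigmaC K Om \<theta> X = Arrow X (\<lambda>x\<in>topspace X. chi_bar K Om \<theta> X x) (ptC_ob K (Om X))"

definition sfc_adj ::
  "('o, 'u) pfc \<Rightarrow> ('u topology \<Rightarrow> 'o) \<Rightarrow> ('u topology \<Rightarrow> ('u set, 'u) arrow) \<Rightarrow>
   ('o, 'u, 'u topology, ('u topology, 'u) arrow) adj" where
  "sfc_adj K Om \<theta> = \<lparr>lcat = Ccat K, rcat = op_cat (TopC K), ladj = ptC K, radj = OmegaC K Om \<theta>,
                     aunit = etaC K Om \<theta>, acounit = sigmaC K Om \<theta>\<rparr>"

definition zeta ::
  "('o, 'u) pfc \<Rightarrow> ('u topology \<Rightarrow> 'o) \<Rightarrow> ('u topology \<Rightarrow> ('u set, 'u) arrow) \<Rightarrow>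
   'u topology \<Rightarrow> ('u gorder, 'u) arrow" where
  "zeta K Om \<theta> X = Arrow (fob (Ofun K) (Om X)) (fn (\<theta> X)) (Opens X)"

definition xi :: "('o, 'u) pfc \<Rightarrow> 'o \<Rightarrow> ('u topology, 'u) arrow" where
  "xi K C = Arrow (ptC_ob K C)
     (\<lambda>f\<in>Hom (Ccat K) C (two_C K). graph (\<iota> K \<circ>\<^bsub>Frm\<^esub> farr (Ofun K) f)) (pt_ob (fob (Ofun K) C))"

end

end

theory Submission
  imports Defs
begin

text \<open>
  Both adjunctions are of one kind. There is a faithful functor \<open>U\<close> to frames and an object \<open>two\<close>
  with \<open>U two \<cong> 2\<close>, so that an arrow \<open>f : C \<rightarrow> two\<close> is a frame map \<open>U C \<rightarrow> 2\<close> of a particular kind;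
  the left adjoint topologises the set of these arrows, and the right adjoint sends a space \<open>X\<close> to
  an object whose \<open>U\<close>-image is in bijection with the opens of \<open>X\<close>, the evaluations at the points
  of \<open>X\<close> being among the arrows to \<open>two\<close>. An arrow to \<open>two\<close> is determined by where it takes the
  value \<open>1\<close>, and an arrow into the object of a space is determined by the open sets that it
  produces. Hence all functor laws, naturality squares and triangle identities reduce to identities
  between subsets of a space. The locale \<open>two_valued_adjunction\<close> carries this out once; it is
  instantiated by \<open>Frm\<close> (\<open>U\<close> the identity) and by an SFC-category (\<open>U = \<O>\<close>).

  For the first instance, a map from a frame to the opens of \<open>X\<close> is a frame map as soon as its
  composites with all \<open>\<chi>\<^sub>x\<close> are (\<open>frame_hom_into_Opens\<close>), since the \<open>\<chi>\<^sub>x\<close> are frame maps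
  and jointly injective. For the second, the defining property of a cartesian lift gives the arrows
  into \<open>\<Omega>\<^sub>\<C> X\<close> (\<open>lift_into_Om\<close>) and, applied to the identity, the lifts of the evaluations
  (\<open>chi_bar\<close>).

  Applied to \<open>\<theta>\<^sub>X\<close>, whose composites \<open>\<chi>\<^sub>x \<theta>\<^sub>X = \<iota> \<O>(chi_bar x)\<close> are frame maps, the same criterion
  shows that \<open>\<theta>\<^sub>X\<close> is a frame map; being bijective, it is an isomorphism of frames
  (\<open>zeta_iso\<close>). The mate equation at \<open>f : C \<rightarrow> two\<close> reads \<open>\<chi>\<^sub>f \<zeta> \<O>\<eta> = \<iota> \<O>f\<close>, which is the
  characterisation of the unit \<open>\<eta>\<close> (\<open>mate_equation\<close>).
\<close>

section \<open>Categories and functors\<close>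

lemma category_Dom_Cod:
  assumes "category A" "f \<in> Hom A X Y"
  shows "X \<in> Ob A" "Y \<in> Ob A"
  using assms by (auto simp: category_def Hom_def)

lemma category_Id: "category A \<Longrightarrow> X \<in> Ob A \<Longrightarrow> Id A X \<in> Hom A X X"
  by (simp add: category_def)

lemma category_comp:
  assumes "category A" "f \<in> Hom A X Y" "g \<in> Hom A Y Z"
  shows "g \<circ>\<^bsub>A\<^esub> f \<in> Hom A X Z"
  using assms unfolding category_def Hom_def by blast

lemma category_comp_Id:
  assumes "category A" "f \<in> Hom A X Y"
  shows "f \<circ>\<^bsub>A\<^esub> Id A X = f" "Id A Y \<circ>\<^bsub>A\<^esub> f = f"
  using assms unfolding category_def Hom_def by blast+

lemma category_assoc:
  assumes "category A" "f \<in> Hom A X Y" "g \<in> Hom A Y Z" "h \<in> Hom A Z W"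
  shows "h \<circ>\<^bsub>A\<^esub> (g \<circ>\<^bsub>A\<^esub> f) = (h \<circ>\<^bsub>A\<^esub> g) \<circ>\<^bsub>A\<^esub> f"
  using assms unfolding category_def Hom_def by blast

lemma categoryI:
  assumes "\<And>f. f \<in> Arr A \<Longrightarrow> Dom A f \<in> Ob A \<and> Cod A f \<in> Ob A"
    and "\<And>X. X \<in> Ob A \<Longrightarrow> Id A X \<in> Hom A X X"
    and "\<And>X Y Z f g. f \<in> Hom A X Y \<Longrightarrow> g \<in> Hom A Y Z \<Longrightarrow> g \<circ>\<^bsub>A\<^esub> f \<in> Hom A X Z"
    and "\<And>X Y f. f \<in> Hom A X Y \<Longrightarrow> f \<circ>\<^bsub>A\<^esub> Id A X = f \<and> Id A Y \<circ>\<^bsub>A\<^esub> f = f"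
    and "\<And>X Y Z W f g h. f \<in> Hom A X Y \<Longrightarrow> g \<in> Hom A Y Z \<Longrightarrow> h \<in> Hom A Z W \<Longrightarrow>
      h \<circ>\<^bsub>A\<^esub> (g \<circ>\<^bsub>A\<^esub> f) = (h \<circ>\<^bsub>A\<^esub> g) \<circ>\<^bsub>A\<^esub> f"
  shows "category A"
  unfolding category_def
proof (intro conjI ballI impI)
  fix f g assume "f \<in> Arr A" "g \<in> Arr A" "Dom A g = Cod A f"
  then show "g \<circ>\<^bsub>A\<^esub> f \<in> Hom A (Dom A f) (Cod A g)"
    by (intro assms(3)) (auto simp: Hom_def)
next
  fix f assume "f \<in> Arr A"
  then have "f \<in> Hom A (Dom A f) (Cod A f)" by (simp add: Hom_def)
  then show "f \<circ>\<^bsub>A\<^esub> Id A (Dom A f) = f" "Id A (Cod A f) \<circ>\<^bsub>A\<^esub> f = f"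
    using assms(4) by blast+
next
  fix f g h assume "f \<in> Arr A" "g \<in> Arr A" "h \<in> Arr A" "Dom A g = Cod A f" "Dom A h = Cod A g"
  then show "h \<circ>\<^bsub>A\<^esub> (g \<circ>\<^bsub>A\<^esub> f) = (h \<circ>\<^bsub>A\<^esub> g) \<circ>\<^bsub>A\<^esub> f"
    by (intro assms(5)) (auto simp: Hom_def)
qed (use assms(1,2) in auto)

lemma Hom_op [simp]: "Hom (op_cat A) X Y = Hom A Y X"
  by (auto simp: Hom_def op_cat_def)

lemma op_cat_simps [simp]:
  "Ob (op_cat A) = Ob A" "Arr (op_cat A) = Arr A" "Dom (op_cat A) = Cod A"
  "Cod (op_cat A) = Dom A" "Id (op_cat A) = Id A" "Comp (op_cat A) g f = f \<circ>\<^bsub>A\<^esub> g"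
  by (simp_all add: op_cat_def)

lemma category_op:
  assumes "category A" shows "category (op_cat A)"
proof (rule categoryI)
  fix X Y Z W f g h
  assume "f \<in> Hom (op_cat A) X Y" "g \<in> Hom (op_cat A) Y Z" "h \<in> Hom (op_cat A) Z W"
  then show "h \<circ>\<^bsub>op_cat A\<^esub> (g \<circ>\<^bsub>op_cat A\<^esub> f) = (h \<circ>\<^bsub>op_cat A\<^esub> g) \<circ>\<^bsub>op_cat A\<^esub> f"
    using category_assoc[OF assms, of h W Z g Y f X] by simp
next
  fix f assume "f \<in> Arr (op_cat A)"
  then show "Dom (op_cat A) f \<in> Ob (op_cat A) \<and> Cod (op_cat A) f \<in> Ob (op_cat A)"
    using assms by (simp add: category_def)
qed (simp_all add: category_Id[OF assms] category_comp[OF assms] category_comp_Id[OF assms])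

lemma full_subcat_simps [simp]:
  "Ob (full_subcat A S) = Ob A \<inter> S"
  "Arr (full_subcat A S) = {f \<in> Arr A. Dom A f \<in> S \<and> Cod A f \<in> S}"
  "Dom (full_subcat A S) = Dom A" "Cod (full_subcat A S) = Cod A" "Id (full_subcat A S) = Id A"
  "Comp (full_subcat A S) = Comp A"
  by (simp_all add: full_subcat_def)

lemma Hom_full_subcat: "Hom (full_subcat A S) X Y = (if X \<in> S \<and> Y \<in> S then Hom A X Y else {})"
  by (auto simp: Hom_def)

lemma category_full_subcat:
  assumes "category A" shows "category (full_subcat A S)"
proof (rule categoryI)
  fix X Y Z W f g h
  assume "f \<in> Hom (full_subcat A S) X Y" "g \<in> Hom (full_subcat A S) Y Z" "h \<in> Hom (full_subcat A S) Z W"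
  then show "h \<circ>\<^bsub>full_subcat A S\<^esub> (g \<circ>\<^bsub>full_subcat A S\<^esub> f) = (h \<circ>\<^bsub>full_subcat A S\<^esub> g) \<circ>\<^bsub>full_subcat A S\<^esub> f"
    using category_assoc[OF assms, of f X Y g Z h W] by (simp add: Hom_full_subcat split: if_splits)
next
  fix f assume "f \<in> Arr (full_subcat A S)"
  then show "Dom (full_subcat A S) f \<in> Ob (full_subcat A S) \<and> Cod (full_subcat A S) f \<in> Ob (full_subcat A S)"
    using assms by (simp add: category_def)
qed (simp_all add: Hom_full_subcat category_Id[OF assms] category_comp[OF assms]
       category_comp_Id[OF assms] split: if_splits)

text \<open>Only the objects of \<open>A\<close> in \<open>S\<close> matter for the full subcategory on \<open>S\<close>.\<close>

lemma full_subcat_Ob: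
  assumes "category A" shows "full_subcat A (Ob A \<inter> S) = full_subcat A S"
proof -
  have "{f \<in> Arr A. Dom A f \<in> Ob A \<inter> S \<and> Cod A f \<in> Ob A \<inter> S} = {f \<in> Arr A. Dom A f \<in> S \<and> Cod A f \<in> S}"
    using assms by (auto simp: category_def)
  then show ?thesis by (simp add: full_subcat_def Int_absorb1)
qed

lemma full_subcat_UNIV: "full_subcat A UNIV = A"
  by (simp add: full_subcat_def)

lemma functor_Hom:
  "is_functor A B F \<Longrightarrow> f \<in> Hom A X Y \<Longrightarrow> farr F f \<in> Hom B (fob F X) (fob F Y)"
  unfolding is_functor_def by (auto simp: Hom_def)

lemma functor_Ob: "is_functor A B F \<Longrightarrow> X \<in> Ob A \<Longrightarrow> fob F X \<in> Ob B"
  unfolding is_functor_def by auto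

lemma functor_Id: "is_functor A B F \<Longrightarrow> X \<in> Ob A \<Longrightarrow> farr F (Id A X) = Id B (fob F X)"
  unfolding is_functor_def by auto

lemma functor_comp:
  "is_functor A B F \<Longrightarrow> f \<in> Hom A X Y \<Longrightarrow> g \<in> Hom A Y Z \<Longrightarrow>
   farr F (g \<circ>\<^bsub>A\<^esub> f) = farr F g \<circ>\<^bsub>B\<^esub> farr F f"
  unfolding is_functor_def by (auto simp: Hom_def)

lemma functorI:
  assumes "category A" "category B" "\<And>X. X \<in> Ob A \<Longrightarrow> fob F X \<in> Ob B"
    and "\<And>X Y f. f \<in> Hom A X Y \<Longrightarrow> farr F f \<in> Hom B (fob F X) (fob F Y)"
    and "\<And>X. X \<in> Ob A \<Longrightarrow> farr F (Id A X) = Id B (fob F X)"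
    and "\<And>X Y Z f g. f \<in> Hom A X Y \<Longrightarrow> g \<in> Hom A Y Z \<Longrightarrow> farr F (g \<circ>\<^bsub>A\<^esub> f) = farr F g \<circ>\<^bsub>B\<^esub> farr F f"
  shows "is_functor A B F"
  unfolding is_functor_def
proof (intro conjI ballI impI)
  fix f g assume "f \<in> Arr A" "g \<in> Arr A" "Dom A g = Cod A f"
  then show "farr F (g \<circ>\<^bsub>A\<^esub> f) = farr F g \<circ>\<^bsub>B\<^esub> farr F f"
    by (intro assms(6)) (auto simp: Hom_def)
qed (use assms(1-5) in \<open>auto simp: Hom_def\<close>)

lemma functor_id: "category A \<Longrightarrow> is_functor A A id_ftor"
  by (rule functorI) (auto simp: id_ftor_def)

lemma functor_compose:
  assumes F: "is_functor A B F" and G: "is_functor B C G"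
  shows "is_functor A C (G \<circ>\<^sub>F F)"
proof (rule functorI)
  show "category A" "category C" using F G by (auto simp: is_functor_def)
next
  fix X Y Z f g assume "f \<in> Hom A X Y" "g \<in> Hom A Y Z"
  then show "farr (G \<circ>\<^sub>F F) (g \<circ>\<^bsub>A\<^esub> f) = farr (G \<circ>\<^sub>F F) g \<circ>\<^bsub>C\<^esub> farr (G \<circ>\<^sub>F F) f"
    by (simp add: comp_ftor_def functor_comp[OF F] functor_comp[OF G functor_Hom[OF F] functor_Hom[OF F]])
qed (simp_all add: comp_ftor_def functor_Hom[OF F] functor_Hom[OF G] functor_Ob[OF F] functor_Ob[OF G]
      functor_Id[OF F] functor_Id[OF G])

lemma nat_transI:
  assumes "is_functor A B F" "is_functor A B G"
    and "\<And>X. X \<in> Ob A \<Longrightarrow> \<tau> X \<in> Hom B (fob F X) (fob G X)"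
    and "\<And>X Y f. f \<in> Hom A X Y \<Longrightarrow> farr G f \<circ>\<^bsub>B\<^esub> \<tau> X = \<tau> Y \<circ>\<^bsub>B\<^esub> farr F f"
  shows "nat_trans A B F G \<tau>"
  unfolding nat_trans_def using assms by (auto simp: Hom_def)

lemma inv_arr_eq:
  assumes "category A" "inverse_arrs A f g"
  shows "inv_arr A f = g"
  unfolding inv_arr_def
proof (rule the_equality)
  fix h assume h: "inverse_arrs A f h"
  let ?X = "Dom A f" and ?Y = "Cod A f"
  have f: "f \<in> Hom A ?X ?Y" and g: "g \<in> Hom A ?Y ?X" and h': "h \<in> Hom A ?Y ?X"
    using assms h by (auto simp: inverse_arrs_def Hom_def)
  have "h = h \<circ>\<^bsub>A\<^esub> (f \<circ>\<^bsub>A\<^esub> g)"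
    using category_comp_Id[OF assms(1) h'] assms(2) by (simp add: inverse_arrs_def)
  also have "\<dots> = (h \<circ>\<^bsub>A\<^esub> f) \<circ>\<^bsub>A\<^esub> g"
    by (rule category_assoc[OF assms(1) g f h'])
  also have "\<dots> = g"
    using category_comp_Id[OF assms(1) g] h by (simp add: inverse_arrs_def)
  finally show "h = g" .
qed (fact assms(2))

lemma inverse_arrs_Hom:
  assumes "f \<in> Hom A X Y" "inverse_arrs A f g"
  shows "g \<in> Hom A Y X" "g \<circ>\<^bsub>A\<^esub> f = Id A X" "f \<circ>\<^bsub>A\<^esub> g = Id A Y"
  using assms by (auto simp: inverse_arrs_def Hom_def)

lemma iso_arr_inv_arr:
  assumes "category A" "iso_arr A f" shows "inverse_arrs A f (inv_arr A f)"
  using assms inv_arr_eq[OF assms(1)] by (auto simp: iso_arr_def)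

lemma the_lift_eq:
  assumes "faithful A U" "X \<in> Ob A" "Y \<in> Ob A" "p \<in> Hom A X Y" "farr U p = f"
  shows "the_lift A U X Y f = p"
  unfolding the_lift_def is_lift_def
  using assms by (auto intro!: the_equality simp: faithful_def inj_on_def)


section \<open>Concrete categories\<close>

lemma concrete_cat_simps [simp]:
  "Ob (concrete_cat obs car mor) = obs" "Dom (concrete_cat obs car mor) = src"
  "Cod (concrete_cat obs car mor) = tgt"
  "Id (concrete_cat obs car mor) X = Arrow X (\<lambda>x\<in>car X. x) X"
  "Comp (concrete_cat obs car mor) q p = Arrow (src p) (compose (car (src p)) (fn q) (fn p)) (tgt q)"
  by (simp_all add: concrete_cat_def)

lemma concrete_cat_Hom:
  "p \<in> Hom (concrete_cat obs car mor) X Y \<longleftrightarrow>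
   X \<in> obs \<and> Y \<in> obs \<and> src p = X \<and> tgt p = Y \<and> fn p \<in> car X \<rightarrow>\<^sub>E car Y \<and> mor X Y (fn p)"
  by (cases p) (auto simp: Hom_def concrete_cat_def)

lemma concrete_cat_eqI:
  assumes "p \<in> Hom (concrete_cat obs car mor) X Y" "q \<in> Hom (concrete_cat obs car mor) X Y"
    and "\<And>x. x \<in> car X \<Longrightarrow> fn p x = fn q x"
  shows "p = q"
proof -
  have "fn p = fn q"
    using assms by (intro PiE_ext[of _ "car X" "\<lambda>_. car Y"]) (auto simp: concrete_cat_Hom)
  then show ?thesis
    using assms(1,2) by (cases p; cases q) (auto simp: concrete_cat_Hom)
qed

lemma category_concrete_cat:
  assumes "\<And>X. X \<in> obs \<Longrightarrow> mor X X (\<lambda>x\<in>car X. x)"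
    and "\<And>X Y Z f g. X \<in> obs \<Longrightarrow> Y \<in> obs \<Longrightarrow> Z \<in> obs \<Longrightarrow> f \<in> car X \<rightarrow>\<^sub>E car Y \<Longrightarrow> g \<in> car Y \<rightarrow>\<^sub>E car Z \<Longrightarrow>
      mor X Y f \<Longrightarrow> mor Y Z g \<Longrightarrow> mor X Z (compose (car X) g f)"
  shows "category (concrete_cat obs car mor)"
proof -
  let ?A = "concrete_cat obs car mor"
  have comp: "g \<circ>\<^bsub>?A\<^esub> f \<in> Hom ?A X Z" if "f \<in> Hom ?A X Y" "g \<in> Hom ?A Y Z" for X Y Z f g
    using that assms(2)[of X Y Z "fn f" "fn g"]
    by (auto simp: concrete_cat_Hom compose_def PiE_def)
  have idn: "Id ?A X \<in> Hom ?A X X" if "X \<in> Ob ?A" for X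
    using that assms(1) by (auto simp: concrete_cat_Hom)
  have ob: "X \<in> Ob ?A" "Y \<in> Ob ?A" if "f \<in> Hom ?A X Y" for X Y f
    using that by (auto simp: concrete_cat_Hom)
  show ?thesis
  proof (rule categoryI)
    fix f assume "f \<in> Arr ?A"
    then show "Dom ?A f \<in> Ob ?A \<and> Cod ?A f \<in> Ob ?A" by (auto simp: concrete_cat_def)
  next
    fix X Y f assume f: "f \<in> Hom ?A X Y"
    have "f \<circ>\<^bsub>?A\<^esub> Id ?A X = f"
      by (rule concrete_cat_eqI[OF comp[OF idn f] f])
        (use f ob in \<open>auto simp: concrete_cat_Hom compose_def\<close>)
    moreover have "Id ?A Y \<circ>\<^bsub>?A\<^esub> f = f"
      by (rule concrete_cat_eqI[OF comp[OF f idn] f])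
        (use f ob in \<open>auto simp: concrete_cat_Hom compose_def\<close>)
    ultimately show "f \<circ>\<^bsub>?A\<^esub> Id ?A X = f \<and> Id ?A Y \<circ>\<^bsub>?A\<^esub> f = f" by blast
  next
    fix X Y Z W f g h assume f: "f \<in> Hom ?A X Y" and g: "g \<in> Hom ?A Y Z" and h: "h \<in> Hom ?A Z W"
    show "h \<circ>\<^bsub>?A\<^esub> (g \<circ>\<^bsub>?A\<^esub> f) = (h \<circ>\<^bsub>?A\<^esub> g) \<circ>\<^bsub>?A\<^esub> f"
      by (rule concrete_cat_eqI[OF comp[OF comp[OF f g] h] comp[OF f comp[OF g h]]])
        (use f g h in \<open>auto simp: concrete_cat_Hom compose_def\<close>)
  qed (use comp idn in auto)
qed


section \<open>Frames of sets\<close>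

lemma sup_eqI:
  assumes "complete_lattice L" "least L s (Upper L S)"
  shows "\<Squnion>\<^bsub>L\<^esub> S = s"
proof -
  interpret complete_lattice L by fact
  show ?thesis unfolding sup_def
    using assms(2) by (rule some_equality) (use least_unique assms(2) in blast)
qed

lemma inf_eqI:
  assumes "complete_lattice L" "greatest L s (Lower L S)"
  shows "\<Sqinter>\<^bsub>L\<^esub> S = s"
proof -
  interpret complete_lattice L by fact
  show ?thesis unfolding inf_def
    using assms(2) by (rule some_equality) (use greatest_unique assms(2) in blast)
qed

lemma top_eqI:
  assumes "complete_lattice L" "greatest L s (carrier L)"
  shows "\<top>\<^bsub>L\<^esub> = s"
proof -
  interpret complete_lattice L by fact
  show ?thesis unfolding top_def
    using assms(2) by (rule some_equality) (use greatest_unique assms(2) in blast)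
qed

text \<open>A family of sets closed under arbitrary unions and binary intersections and with a largest
  member \<open>W\<close> is a frame. The two-element frame and the opens of a space are of this form, up to the
  injection \<open>E\<close> that takes an element of the frame to the set it stands for.\<close>

locale set_frame =
  fixes L :: "'u gorder" and E :: "'u \<Rightarrow> 'v set" and W :: "'v set"
  assumes eq_L: "eq L = (=)"
    and inj_E: "inj_on E (carrier L)"
    and le_L: "a \<in> carrier L \<Longrightarrow> b \<in> carrier L \<Longrightarrow> le L a b \<longleftrightarrow> E a \<subseteq> E b"
    and union_L: "S \<subseteq> carrier L \<Longrightarrow> \<Union>(E ` S) \<in> E ` carrier L"
    and inter_L: "a \<in> carrier L \<Longrightarrow> b \<in> carrier L \<Longrightarrow> E a \<inter> E b \<in> E ` carrier L"
    and top_L: "W \<in> E ` carrier L" and below_W: "a \<in> carrier L \<Longrightarrow> E a \<subseteq> W"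
begin

lemma least_Upper:
  assumes S: "S \<subseteq> carrier L" and s: "s \<in> carrier L" "E s = \<Union>(E ` S)"
  shows "least L s (Upper L S)"
  unfolding least_def
proof (intro conjI ballI)
  have "le L x s" if "x \<in> S" for x
    using le_L[of x s] that S s by auto
  then show "s \<in> Upper L S" using s(1) by (simp add: Upper_def)
  fix u assume u: "u \<in> Upper L S"
  then have uL: "u \<in> carrier L" by (simp add: Upper_def)
  have "E x \<subseteq> E u" if "x \<in> S" for x
    using le_L[of x u] that S u by (auto simp: Upper_def)
  then show "le L s u" using le_L[OF s(1) uL] s(2) by blast
qed (simp add: Upper_def)

text \<open>Infima need not be intersections: the infimum is the union of all lower bounds.\<close>

lemma greatest_Lower:
  assumes S: "S \<subseteq> carrier L" and s: "s \<in> carrier L" "E s = \<Union>(E ` Lower L S)"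
  shows "greatest L s (Lower L S)"
  unfolding greatest_def
proof (intro conjI ballI)
  have "le L s x" if "x \<in> S" for x
  proof -
    have x: "x \<in> carrier L" using that S by blast
    have "E l \<subseteq> E x" if "l \<in> Lower L S" for l
      using le_L[of l x] that x \<open>x \<in> S\<close> by (auto simp: Lower_def)
    then show ?thesis using le_L[OF s(1) x] s(2) by blast
  qed
  then show "s \<in> Lower L S" using s(1) by (simp add: Lower_def)
  fix l assume l: "l \<in> Lower L S"
  then have "l \<in> carrier L" by (simp add: Lower_def)
  then show "le L l s" using le_L[OF _ s(1)] s(2) l by blast
qed (simp add: Lower_def)

lemma complete_lattice_L: "complete_lattice L"
proof -
  interpret partial_order L
    by unfold_locales (use le_L inj_E in \<open>auto simp: eq_L inj_on_def\<close>)
  show ?thesis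
  proof (rule complete_latticeI)
    fix S assume S: "S \<subseteq> carrier L"
    show "\<exists>s. least L s (Upper L S)"
      using union_L[OF S] least_Upper[OF S] by (metis image_iff)
    have "Lower L S \<subseteq> carrier L" by (simp add: Lower_def)
    from union_L[OF this] show "\<exists>s. greatest L s (Lower L S)"
      using greatest_Lower[OF S] by (metis image_iff)
  qed
qed

lemma E_sup:
  assumes "S \<subseteq> carrier L" shows "E (\<Squnion>\<^bsub>L\<^esub> S) = \<Union>(E ` S)"
proof -
  obtain s where s: "s \<in> carrier L" "E s = \<Union>(E ` S)" using union_L[OF assms] by (metis image_iff)
  then have "\<Squnion>\<^bsub>L\<^esub> S = s"
    by (intro sup_eqI complete_lattice_L least_Upper assms)
  with s show ?thesis by simp
qed

lemma E_meet:
  assumes "a \<in> carrier L" "b \<in> carrier L" shows "E (a \<sqinter>\<^bsub>L\<^esub> b) = E a \<inter> E b"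
proof -
  obtain s where s: "s \<in> carrier L" "E s = E a \<inter> E b" using inter_L[OF assms] by (metis image_iff)
  have "greatest L s (Lower L {a, b})"
    using s assms le_L by (auto simp: greatest_def Lower_def)
  then have "a \<sqinter>\<^bsub>L\<^esub> b = s"
    unfolding meet_def by (intro inf_eqI complete_lattice_L)
  with s show ?thesis by simp
qed

lemma E_top: "E (\<top>\<^bsub>L\<^esub>) = W"
proof -
  obtain s where s: "s \<in> carrier L" "E s = W" using top_L by (metis image_iff)
  then have "\<top>\<^bsub>L\<^esub> = s"
    using le_L below_W by (intro top_eqI complete_lattice_L) (auto simp: greatest_def)
  with s show ?thesis by simp
qed

lemma frame_L: "frame L"
  unfolding frame_def
proof (intro conjI ballI allI impI complete_lattice_L)
  fix a S assume a: "a \<in> carrier L" and S: "S \<subseteq> carrier L"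
  interpret complete_lattice L by (rule complete_lattice_L)
  have sub: "(\<lambda>s. a \<sqinter>\<^bsub>L\<^esub> s) ` S \<subseteq> carrier L"
    using a S by auto
  have "E (a \<sqinter>\<^bsub>L\<^esub> \<Squnion>\<^bsub>L\<^esub> S) = (\<Union>s\<in>S. E a \<inter> E s)"
    using a S by (auto simp: E_sup E_meet)
  also have "\<dots> = E (\<Squnion>\<^bsub>L\<^esub> ((\<lambda>s. a \<sqinter>\<^bsub>L\<^esub> s) ` S))"
    using a S E_meet by (fastforce simp: E_sup[OF sub])
  finally show "a \<sqinter>\<^bsub>L\<^esub> \<Squnion>\<^bsub>L\<^esub> S = \<Squnion>\<^bsub>L\<^esub> ((\<lambda>s. a \<sqinter>\<^bsub>L\<^esub> s) ` S)"
    using a S sub by (intro inj_onD[OF inj_E]) auto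
qed

end

lemma frame_sup_closed:
  assumes "frame L" "S \<subseteq> carrier L" shows "\<Squnion>\<^bsub>L\<^esub> S \<in> carrier L"
proof -
  interpret complete_lattice L using assms by (simp add: frame_def)
  show ?thesis using assms by simp
qed

lemma frame_meet_closed:
  assumes "frame L" "a \<in> carrier L" "b \<in> carrier L" shows "a \<sqinter>\<^bsub>L\<^esub> b \<in> carrier L"
proof -
  interpret complete_lattice L using assms by (simp add: frame_def)
  show ?thesis using assms by simp
qed

lemma frame_top_closed: 
  assumes "frame L" shows "\<top>\<^bsub>L\<^esub> \<in> carrier L"
proof -
  interpret complete_lattice L using assms by (simp add: frame_def)
  show ?thesis by simp
qed

lemma frame_homI:
  assumes "\<And>a. a \<in> carrier L \<Longrightarrow> f a \<in> carrier M"
    and "\<And>S. S \<subseteq> carrier L \<Longrightarrow> f (\<Squnion>\<^bsub>L\<^esub> S) = \<Squnion>\<^bsub>M\<^esub> (f ` S)"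
    and "f (\<top>\<^bsub>L\<^esub>) = \<top>\<^bsub>M\<^esub>"
    and "\<And>a b. a \<in> carrier L \<Longrightarrow> b \<in> carrier L \<Longrightarrow> f (a \<sqinter>\<^bsub>L\<^esub> b) = f a \<sqinter>\<^bsub>M\<^esub> f b"
  shows "frame_hom L M f"
  using assms by (auto simp: frame_hom_def)

lemma frame_homD:
  assumes "frame_hom L M f"
  shows "a \<in> carrier L \<Longrightarrow> f a \<in> carrier M"
    and "S \<subseteq> carrier L \<Longrightarrow> f (\<Squnion>\<^bsub>L\<^esub> S) = \<Squnion>\<^bsub>M\<^esub> (f ` S)"
    and "f (\<top>\<^bsub>L\<^esub>) = \<top>\<^bsub>M\<^esub>"
    and "a \<in> carrier L \<Longrightarrow> b \<in> carrier L \<Longrightarrow> f (a \<sqinter>\<^bsub>L\<^esub> b) = f a \<sqinter>\<^bsub>M\<^esub> f b"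
  using assms by (auto simp: frame_hom_def)

lemma frame_hom_cong:
  assumes f: "frame_hom L M f" and L: "frame L" and eq: "\<And>a. a \<in> carrier L \<Longrightarrow> f a = g a"
  shows "frame_hom L M g"
proof (rule frame_homI)
  fix S assume S: "S \<subseteq> carrier L"
  then have "f ` S = g ` S" using eq by (intro image_cong) auto
  then show "g (\<Squnion>\<^bsub>L\<^esub> S) = \<Squnion>\<^bsub>M\<^esub> (g ` S)"
    using frame_homD(2)[OF f S] eq[OF frame_sup_closed[OF L S]] by simp
qed (use eq frame_homD[OF f] frame_top_closed[OF L] frame_meet_closed[OF L] in \<open>metis+\<close>)

lemma frame_hom_id: "frame L \<Longrightarrow> frame_hom L L (\<lambda>x\<in>carrier L. x)"
  by (rule frame_hom_cong[of _ _ "\<lambda>x. x"]) (auto intro: frame_homI)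

lemma frame_hom_compose:
  assumes f: "frame_hom L M f" and g: "frame_hom M N g" and L: "frame L"
  shows "frame_hom L N (compose (carrier L) g f)"
proof (rule frame_hom_cong[OF _ L])
  show "frame_hom L N (g \<circ> f)"
  proof (rule frame_homI)
    fix S assume S: "S \<subseteq> carrier L"
    then have "f ` S \<subseteq> carrier M" using frame_homD(1)[OF f] by auto
    then show "(g \<circ> f) (\<Squnion>\<^bsub>L\<^esub> S) = \<Squnion>\<^bsub>N\<^esub> ((g \<circ> f) ` S)"
      by (simp add: frame_homD(2)[OF f S] frame_homD(2)[OF g] image_comp)
  qed (simp_all add: frame_homD[OF f] frame_homD[OF g])
qed (simp add: compose_def)

lemma frame_hom_inverse:
  assumes f: "frame_hom L M f" and L: "frame L" and bij: "bij_betw f (carrier L) (carrier M)"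
    and g: "\<And>a. a \<in> carrier L \<Longrightarrow> g (f a) = a"
  shows "frame_hom M L g"
proof -
  have gL: "g b \<in> carrier L" and fg: "f (g b) = b" if "b \<in> carrier M" for b
    using that bij g by (metis bij_betw_imp_surj_on imageE)+
  show ?thesis
  proof (rule frame_homI)
    fix S assume S: "S \<subseteq> carrier M"
    have gS: "g ` S \<subseteq> carrier L" using gL S by auto
    have "f ` (g ` S) = S" using fg S by (force simp: image_image)
    then have "f (\<Squnion>\<^bsub>L\<^esub> (g ` S)) = \<Squnion>\<^bsub>M\<^esub> S"
      using frame_homD(2)[OF f gS] by simp
    then show "g (\<Squnion>\<^bsub>M\<^esub> S) = \<Squnion>\<^bsub>L\<^esub> (g ` S)"
      using g[OF frame_sup_closed[OF L gS]] by simp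
  next
    show "g (\<top>\<^bsub>M\<^esub>) = \<top>\<^bsub>L\<^esub>"
      using g[OF frame_top_closed[OF L]] frame_homD(3)[OF f] by simp
  next
    fix a b assume ab: "a \<in> carrier M" "b \<in> carrier M"
    show "g (a \<sqinter>\<^bsub>M\<^esub> b) = g a \<sqinter>\<^bsub>L\<^esub> g b"
      using g[OF frame_meet_closed[OF L gL gL], OF ab] frame_homD(4)[OF f gL gL, OF ab] fg ab by simp
  qed (fact gL)
qed

section \<open>Small sets and graphs\<close>

context universe
begin

lemma small_elts [simp]: "small (elts a)"
  by (simp add: small_def)

lemma set_of_elts [simp]: "set_of (elts a) = a"
  by (simp add: set_of_def the_inv_f_f elts_inject)

lemma elts_set_of [simp]: "small S \<Longrightarrow> elts (set_of S) = S"
  by (auto simp: small_def)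

lemma set_of_inject: "small S \<Longrightarrow> small S' \<Longrightarrow> set_of S = set_of S' \<longleftrightarrow> S = S'"
  by (metis elts_set_of)

lemma small_subset: "small S \<Longrightarrow> S' \<subseteq> S \<Longrightarrow> small S'"
  using separation by (auto simp: small_def)

lemma small_image: "small S \<Longrightarrow> small (f ` S)"
  using replacement by (auto simp: small_def)

lemma small_empty [simp]: "small {}"
  using small_subset[OF small_elts] by blast

lemma small_Pow: "small S \<Longrightarrow> small (set_of ` Pow S)"
proof -
  assume S: "small S"
  have "{x. elts x \<subseteq> elts (set_of S)} = set_of ` Pow S"
  proof (intro equalityI subsetI)
    fix x assume "x \<in> {x. elts x \<subseteq> elts (set_of S)}"
    then have "elts x \<in> Pow S" using S by simp
    then have "set_of (elts x) \<in> set_of ` Pow S" by (rule imageI)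
    then show "x \<in> set_of ` Pow S" by simp
  next
    fix x assume "x \<in> set_of ` Pow S"
    then obtain B where "B \<subseteq> S" "x = set_of B" by blast
    then show "x \<in> {x. elts x \<subseteq> elts (set_of S)}" using S small_subset[OF S] by simp
  qed
  then show ?thesis using power[of "set_of S"] by (simp add: small_def)
qed

lemma small_UN:
  assumes "small S" "\<And>x. x \<in> S \<Longrightarrow> small (B x)" shows "small (\<Union>x\<in>S. B x)"
proof -
  have "small ((\<lambda>x. set_of (B x)) ` S)" by (rule small_image) fact
  then have "(\<Union>x\<in>elts (set_of ((\<lambda>x. set_of (B x)) ` S)). elts x) = (\<Union>x\<in>S. B x)"
    using assms(2) by simp
  then show ?thesis using union by (metis small_def)
qed

lemma elts_zero [simp]: "elts zero = {}"
  by (simp add: zero_def)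

lemma small_zero: "small {zero}"
proof -
  have "set_of ` Pow {} = {zero}" by (simp add: zero_def)
  then show ?thesis using small_Pow[OF small_empty] by simp
qed

lemma elts_one [simp]: "elts one = {zero}"
  by (simp add: one_def small_zero)

lemma zero_neq_one [simp]: "zero \<noteq> one" "one \<noteq> zero"
proof -
  have "elts zero \<noteq> elts one" by simp
  then show "zero \<noteq> one" "one \<noteq> zero" by metis+
qed

text \<open>The power set of \<open>{zero}\<close> has two elements, so replacement yields all pairs.\<close>

lemma small_two: "small {zero, one}"
proof -
  have "set_of ` Pow {zero} = {zero, one}" by (auto simp: zero_def[symmetric] one_def Pow_insert)
  then show ?thesis using small_Pow[OF small_zero] by simp
qed

lemma small_pair [simp]: "small {x, y}"
proof -
  have "(\<lambda>z. if z = zero then x else y) ` {zero, one} = {x, y}" by auto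
  then show ?thesis using small_image[OF small_two] by metis
qed

lemma small_singleton [simp]: "small {x}"
  using small_pair[of x x] by simp

lemma kpair_inject: "kpair x y = kpair x' y' \<longleftrightarrow> x = x' \<and> y = y'"
  by (auto simp: kpair_def set_of_inject doubleton_eq_iff)

lemma graph_inject:
  assumes "p \<in> Hom Frm L M" "q \<in> Hom Frm L M" "graph p = graph q"
  shows "p = q"
proof (rule concrete_cat_eqI)
  show "p \<in> Hom (concrete_cat {L. frame L \<and> small (carrier L)} carrier frame_hom) L M"
    "q \<in> Hom (concrete_cat {L. frame L \<and> small (carrier L)} carrier frame_hom) L M"
    using assms by (simp_all add: Frm_def)
  then have src: "src p = L" "src q = L" and L: "small (carrier L)"
    by (auto simp: concrete_cat_Hom)
  have "(\<lambda>a. kpair a (fn p a)) ` carrier L = (\<lambda>a. kpair a (fn q a)) ` carrier L"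
    using assms(3) by (simp add: graph_def src set_of_inject small_image[OF L])
  then show "fn p a = fn q a" if "a \<in> carrier L" for a
    using that by (force simp: kpair_inject image_iff set_eq_iff)
qed

text \<open>A graph is a subset of \<open>L \<times> M\<close>, so the set of all graphs is part of a power set.\<close>

lemma small_graphs: "small (graph ` Hom Frm L M)"
proof (cases "small (carrier L) \<and> small (carrier M)")
  case True
  let ?P = "\<Union>a\<in>carrier L. kpair a ` carrier M"
  have P: "small ?P" using True by (intro small_UN small_image) auto
  have "graph p \<in> set_of ` Pow ?P" if "p \<in> Hom Frm L M" for p
    using that by (auto simp: graph_def Frm_def concrete_cat_Hom PiE_def intro!: imageI)
  then show ?thesis by (intro small_subset[OF small_Pow[OF P]]) auto
next
  case False
  then have "Hom Frm L M = {}" by (auto simp: Frm_def concrete_cat_Hom)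
  then show ?thesis by simp
qed

lemma of_graph_graph: "p \<in> Hom Frm L Two \<Longrightarrow> of_graph L (graph p) = p"
  unfolding of_graph_def by (rule the_inv_into_f_f) (auto intro: inj_onI graph_inject)


section \<open>Small frames and small spaces\<close>

lemma Frm_Hom:
  "p \<in> Hom Frm L M \<longleftrightarrow> frame L \<and> small (carrier L) \<and> frame M \<and> small (carrier M) \<and>
     src p = L \<and> tgt p = M \<and> fn p \<in> carrier L \<rightarrow>\<^sub>E carrier M \<and> frame_hom L M (fn p)"
  by (auto simp: Frm_def concrete_cat_Hom)

lemma Top_Hom:
  "p \<in> Hom Top X Y \<longleftrightarrow> small (topspace X) \<and> small (topspace Y) \<and> src p = X \<and> tgt p = Y \<and>
     fn p \<in> topspace X \<rightarrow>\<^sub>E topspace Y \<and> continuous_map X Y (fn p)"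
  by (auto simp: Top_def concrete_cat_Hom)

lemma SetC_Hom:
  "p \<in> Hom SetC A B \<longleftrightarrow> small A \<and> small B \<and> src p = A \<and> tgt p = B \<and> fn p \<in> A \<rightarrow>\<^sub>E B"
  by (auto simp: SetC_def concrete_cat_Hom)

lemma Ob_Frm: "L \<in> Ob Frm \<longleftrightarrow> frame L \<and> small (carrier L)"
  by (simp add: Frm_def)

lemma Ob_Top: "X \<in> Ob Top \<longleftrightarrow> small (topspace X)"
  by (simp add: Top_def)

lemma Ob_SetC: "A \<in> Ob SetC \<longleftrightarrow> small A"
  by (simp add: SetC_def)

lemma category_SetC: "category SetC"
  unfolding SetC_def by (rule category_concrete_cat) auto

lemma category_Frm: "category Frm"
  unfolding Frm_def by (rule category_concrete_cat) (auto intro: frame_hom_id frame_hom_compose)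

lemma category_Top: "category Top"
  unfolding Top_def
proof (rule category_concrete_cat)
  fix X :: "'u topology"
  show "continuous_map X X (\<lambda>x\<in>topspace X. x)"
    by (rule continuous_map_eq[of _ _ "\<lambda>x. x"]) auto
next
  fix X Y Z :: "'u topology" and f g assume "continuous_map X Y f" "continuous_map Y Z g"
  then show "continuous_map X Z (compose (topspace X) g f)"
    by (rule continuous_map_eq[OF continuous_map_compose]) (simp add: compose_def)
qed

lemma Frm_eqI:
  "p \<in> Hom Frm L M \<Longrightarrow> q \<in> Hom Frm L M \<Longrightarrow> (\<And>a. a \<in> carrier L \<Longrightarrow> fn p a = fn q a) \<Longrightarrow> p = q"
  unfolding Frm_def by (rule concrete_cat_eqI)

lemma Top_eqI:
  "p \<in> Hom Top X Y \<Longrightarrow> q \<in> Hom Top X Y \<Longrightarrow> (\<And>x. x \<in> topspace X \<Longrightarrow> fn p x = fn q x) \<Longrightarrow> p = q"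
  unfolding Top_def by (rule concrete_cat_eqI)

lemma SetC_eqI:
  "p \<in> Hom SetC A B \<Longrightarrow> q \<in> Hom SetC A B \<Longrightarrow> (\<And>x. x \<in> A \<Longrightarrow> fn p x = fn q x) \<Longrightarrow> p = q"
  unfolding SetC_def by (rule concrete_cat_eqI)

lemma fn_comp_Frm [simp]: "a \<in> carrier (src p) \<Longrightarrow> fn (q \<circ>\<^bsub>Frm\<^esub> p) a = fn q (fn p a)"
  by (simp add: Frm_def compose_def)

lemma fn_comp_Top [simp]: "a \<in> topspace (src p) \<Longrightarrow> fn (q \<circ>\<^bsub>Top\<^esub> p) a = fn q (fn p a)"
  by (simp add: Top_def compose_def)

lemma fn_comp_SetC [simp]: "a \<in> src p \<Longrightarrow> fn (q \<circ>\<^bsub>SetC\<^esub> p) a = fn q (fn p a)"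
  by (simp add: SetC_def compose_def)

lemma fn_Id_Frm [simp]: "a \<in> carrier L \<Longrightarrow> fn (Id Frm L) a = a"
  by (simp add: Frm_def)

lemma fn_Id_Top [simp]: "a \<in> topspace X \<Longrightarrow> fn (Id Top X) a = a"
  by (simp add: Top_def)

lemma fn_Id_SetC [simp]: "a \<in> A \<Longrightarrow> fn (Id SetC A) a = a"
  by (simp add: SetC_def)

lemma carrier_Two [simp]: "carrier Two = {zero, one}"
  by (simp add: Two_def)

text \<open>The elements of \<open>Two\<close> are themselves sets: \<open>zero = {}\<close> and \<open>one = {zero}\<close>.\<close>

lemma set_frame_Two: "set_frame Two elts {zero}"
proof unfold_locales
  have E: "elts ` carrier Two = {{}, {zero}}" by auto
  show "\<Union>(elts ` S) \<in> elts ` carrier Two" if "S \<subseteq> carrier Two" for S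
  proof -
    have "\<Union>(elts ` S) \<subseteq> {zero}" using that by auto
    then show ?thesis unfolding E by (auto dest: subset_singletonD)
  qed
  show "le Two a b \<longleftrightarrow> elts a \<subseteq> elts b" if "a \<in> carrier Two" "b \<in> carrier Two" for a b
  proof -
    have "a = zero \<or> a = one" "b = zero \<or> b = one" using that by simp_all
    then show ?thesis by (elim disjE) (simp_all add: Two_def)
  qed
  show "inj_on elts (carrier Two)" using elts_inject by (rule inj_on_subset) simp
  show "elts a \<inter> elts b \<in> elts ` carrier Two" if "a \<in> carrier Two" "b \<in> carrier Two" for a b
  proof -
    have "a = zero \<or> a = one" "b = zero \<or> b = one" using that by simp_all
    then show ?thesis unfolding E by (elim disjE) simp_all
  qed
  show "eq Two = (=)" by (simp add: Two_def)
qed auto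

lemma Two_Ob: "Two \<in> Ob Frm"
  using set_frame.frame_L[OF set_frame_Two] by (simp add: Ob_Frm small_two)

lemma carrier_Opens: "carrier (Opens X) = set_of ` {U. openin X U}"
  by (simp add: Opens_def)

lemma small_openin: "small (topspace X) \<Longrightarrow> openin X U \<Longrightarrow> small U"
  by (rule small_subset[OF _ openin_subset])

lemma Opens_elts: 
  assumes "small (topspace X)" shows "a \<in> carrier (Opens X) \<longleftrightarrow> openin X (elts a)"
proof
  assume "openin X (elts a)"
  then have "set_of (elts a) \<in> carrier (Opens X)" unfolding carrier_Opens by blast
  then show "a \<in> carrier (Opens X)" by simp
qed (use small_openin[OF assms] in \<open>auto simp: carrier_Opens\<close>)

lemma set_of_Opens: "openin X U \<Longrightarrow> set_of U \<in> carrier (Opens X)"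
  by (simp add: carrier_Opens)

lemma elts_image_Opens:
  assumes "small (topspace X)" shows "elts ` carrier (Opens X) = {U. openin X U}"
  using small_openin[OF assms] by (force simp: carrier_Opens image_image)

lemma set_frame_Opens:
  assumes "small (topspace X)" shows "set_frame (Opens X) elts (topspace X)"
proof unfold_locales
  show "inj_on elts (carrier (Opens X))" using elts_inject by (rule inj_on_subset) simp
  show "\<Union>(elts ` S) \<in> elts ` carrier (Opens X)" if "S \<subseteq> carrier (Opens X)" for S
    using that by (auto simp: elts_image_Opens[OF assms] Opens_elts[OF assms] subset_iff)
  show "eq (Opens X) = (=)" "le (Opens X) a b \<longleftrightarrow> elts a \<subseteq> elts b" for a b
    by (simp_all add: Opens_def)
qed (simp_all add: elts_image_Opens[OF assms] Opens_elts[OF assms] openin_subset openin_Int)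

lemma Opens_Ob: 
  assumes "small (topspace X)" shows "Opens X \<in> Ob Frm"
proof -
  have "small (carrier (Opens X))"
    by (rule small_subset[OF small_Pow[OF assms]]) (auto simp: carrier_Opens dest: openin_subset)
  then show ?thesis
    using set_frame.frame_L[OF set_frame_Opens[OF assms]] by (simp add: Ob_Frm)
qed

lemma chi_fun_apply:
  "a \<in> carrier (Opens X) \<Longrightarrow> chi_fun X x a = (if x \<in> elts a then one else zero)"
  by (simp add: chi_fun_def)

lemma elts_chi_fun:
  "a \<in> carrier (Opens X) \<Longrightarrow> elts (chi_fun X x a) = (if x \<in> elts a then {zero} else {})"
  by (simp add: chi_fun_apply)

lemma Two_eqI: "a \<in> carrier Two \<Longrightarrow> b \<in> carrier Two \<Longrightarrow> a = one \<longleftrightarrow> b = one \<Longrightarrow> a = b"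
  by auto

lemma frame_hom_Two_sup:
  assumes f: "frame_hom L Two f" and S: "S \<subseteq> carrier L"
  shows "f (\<Squnion>\<^bsub>L\<^esub> S) = one \<longleftrightarrow> (\<exists>a\<in>S. f a = one)"
proof -
  interpret T: set_frame Two elts "{zero}" by (rule set_frame_Two)
  have fa: "f a = zero \<or> f a = one" if "a \<in> carrier L" for a
    using frame_homD(1)[OF f that] by simp
  have sub: "f ` S \<subseteq> carrier Two" using fa S by auto
  then have "\<Squnion>\<^bsub>Two\<^esub> (f ` S) = zero \<or> \<Squnion>\<^bsub>Two\<^esub> (f ` S) = one"
    using frame_sup_closed[OF T.frame_L sub] by simp
  then have "f (\<Squnion>\<^bsub>L\<^esub> S) = one \<longleftrightarrow> zero \<in> elts (f (\<Squnion>\<^bsub>L\<^esub> S))"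
    using frame_homD(2)[OF f S] by auto
  also have "\<dots> \<longleftrightarrow> (\<exists>a\<in>S. zero \<in> elts (f a))"
    using frame_homD(2)[OF f S] T.E_sup[OF sub] by auto
  also have "\<dots> \<longleftrightarrow> (\<exists>a\<in>S. f a = one)"
    using fa S by (intro bex_cong refl) force
  finally show ?thesis .
qed

lemma frame_hom_Two_meet:
  assumes f: "frame_hom L Two f" and ab: "a \<in> carrier L" "b \<in> carrier L"
  shows "f (a \<sqinter>\<^bsub>L\<^esub> b) = one \<longleftrightarrow> f a = one \<and> f b = one"
proof -
  interpret T: set_frame Two elts "{zero}" by (rule set_frame_Two)
  have sub: "f a \<in> carrier Two" "f b \<in> carrier Two"
    using frame_homD(1)[OF f] ab by auto
  have one_iff: "x = one \<longleftrightarrow> zero \<in> elts x" if "x \<in> carrier Two" for x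
    using that by auto
  have "f (a \<sqinter>\<^bsub>L\<^esub> b) = one \<longleftrightarrow> zero \<in> elts (f a \<sqinter>\<^bsub>Two\<^esub> f b)"
    unfolding frame_homD(4)[OF f ab] by (rule one_iff[OF frame_meet_closed[OF T.frame_L sub]])
  also have "\<dots> \<longleftrightarrow> f a = one \<and> f b = one"
    unfolding T.E_meet[OF sub] using one_iff[OF sub(1)] one_iff[OF sub(2)] by simp
  finally show ?thesis .
qed

lemma frame_hom_Two_top:
  assumes "frame_hom L Two f" shows "f (\<top>\<^bsub>L\<^esub>) = one"
proof -
  interpret T: set_frame Two elts "{zero}" by (rule set_frame_Two)
  have "\<top>\<^bsub>Two\<^esub> = one"
    using frame_top_closed[OF T.frame_L] T.E_top by auto
  then show ?thesis using frame_homD(3)[OF assms] by simp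
qed

lemma frame_hom_chi_fun:
  assumes X: "small (topspace X)" and x: "x \<in> topspace X"
  shows "frame_hom (Opens X) Two (chi_fun X x)"
proof -
  interpret L: set_frame "Opens X" elts "topspace X" by (rule set_frame_Opens[OF X])
  interpret T: set_frame Two elts "{zero}" by (rule set_frame_Two)
  have eqI: "a = b" if "elts a = elts b" for a b using that elts_inject by (meson injD)
  show ?thesis
  proof (rule frame_homI)
    show chi: "chi_fun X x a \<in> carrier Two" if "a \<in> carrier (Opens X)" for a
      using that by (simp add: chi_fun_apply)
    fix S assume S: "S \<subseteq> carrier (Opens X)"
    then have "chi_fun X x ` S \<subseteq> carrier Two" using chi by blast
    then have "elts (\<Squnion>\<^bsub>Two\<^esub> (chi_fun X x ` S)) = (\<Union>a\<in>S. elts (chi_fun X x a))"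
      by (simp add: T.E_sup)
    also have "\<dots> = (if x \<in> \<Union>(elts ` S) then {zero} else {})"
      using S by (auto simp: elts_chi_fun subset_iff split: if_splits)
    also have "\<dots> = elts (chi_fun X x (\<Squnion>\<^bsub>Opens X\<^esub> S))"
      using S by (simp add: elts_chi_fun frame_sup_closed L.frame_L L.E_sup)
    finally show "chi_fun X x (\<Squnion>\<^bsub>Opens X\<^esub> S) = \<Squnion>\<^bsub>Two\<^esub> (chi_fun X x ` S)"
      by (intro eqI) simp
  next
    show "chi_fun X x (\<top>\<^bsub>Opens X\<^esub>) = \<top>\<^bsub>Two\<^esub>"
      using x by (intro eqI) (simp add: elts_chi_fun frame_top_closed L.frame_L L.E_top T.E_top)
  next
    fix a b assume ab: "a \<in> carrier (Opens X)" "b \<in> carrier (Opens X)"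
    then show "chi_fun X x (a \<sqinter>\<^bsub>Opens X\<^esub> b) = chi_fun X x a \<sqinter>\<^bsub>Two\<^esub> chi_fun X x b"
      by (intro eqI) (auto simp: elts_chi_fun frame_meet_closed L.frame_L L.E_meet T.E_meet chi_fun_apply)
  qed
qed

text \<open>The evaluations \<open>chi_fun X x\<close> jointly detect frame maps into the opens of \<open>X\<close>: they are frame
  maps, and an open set is determined by its values under them. Here \<open>e x\<close> is the composite of
  \<open>h\<close> with the evaluation at \<open>x\<close>.\<close>

lemma frame_hom_into_Opens:
  assumes X: "small (topspace X)" and D: "frame D"
    and h: "\<And>a. a \<in> carrier D \<Longrightarrow> h a \<in> carrier (Opens X)"
    and e: "\<And>x. x \<in> topspace X \<Longrightarrow> frame_hom D Two (e x)"
    and he: "\<And>x a. x \<in> topspace X \<Longrightarrow> a \<in> carrier D \<Longrightarrow> x \<in> elts (h a) \<longleftrightarrow> e x a = one"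
  shows "frame_hom D (Opens X) h"
proof -
  have L: "frame (Opens X)" using Opens_Ob[OF X] by (simp add: Ob_Frm)
  have chi_h: "chi_fun X x (h a) = e x a" if "x \<in> topspace X" "a \<in> carrier D" for x a
    using that he frame_homD(1)[OF e[OF that(1)] that(2)] by (auto simp: chi_fun_apply h)
  have eqI: "b = c" if "b \<in> carrier (Opens X)" "c \<in> carrier (Opens X)"
    "\<And>x. x \<in> topspace X \<Longrightarrow> chi_fun X x b = chi_fun X x c" for b c
  proof -
    have "x \<in> elts b \<longleftrightarrow> x \<in> elts c" if "x \<in> topspace X" for x
      using \<open>\<And>x. x \<in> topspace X \<Longrightarrow> chi_fun X x b = chi_fun X x c\<close>[OF that] \<open>b \<in> _\<close> \<open>c \<in> _\<close>
      by (simp add: chi_fun_apply split: if_splits)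
    moreover have "elts b \<subseteq> topspace X" "elts c \<subseteq> topspace X"
      using \<open>b \<in> _\<close> \<open>c \<in> _\<close> by (auto simp: Opens_elts[OF X] dest: openin_subset)
    ultimately have "elts b = elts c" by blast
    then show ?thesis using elts_inject by (meson injD)
  qed
  note chi_hom = frame_homD[OF frame_hom_chi_fun[OF X]]
  show ?thesis
  proof (rule frame_homI)
    fix S assume S: "S \<subseteq> carrier D"
    then have hS: "h ` S \<subseteq> carrier (Opens X)" using h by auto
    show "h (\<Squnion>\<^bsub>D\<^esub> S) = \<Squnion>\<^bsub>Opens X\<^esub> (h ` S)"
    proof (rule eqI)
      fix x assume x: "x \<in> topspace X"
      have "chi_fun X x (h (\<Squnion>\<^bsub>D\<^esub> S)) = \<Squnion>\<^bsub>Two\<^esub> (e x ` S)"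
        using frame_homD(2)[OF e[OF x] S] chi_h[OF x frame_sup_closed[OF D S]] by simp
      also have "e x ` S = chi_fun X x ` (h ` S)"
        using S chi_h[OF x] by (auto simp: image_image subset_iff intro!: image_cong)
      finally show "chi_fun X x (h (\<Squnion>\<^bsub>D\<^esub> S)) = chi_fun X x (\<Squnion>\<^bsub>Opens X\<^esub> (h ` S))"
        using chi_hom(2)[OF x hS] by simp
    qed (rule h[OF frame_sup_closed[OF D S]], rule frame_sup_closed[OF L hS])
  next
    show "h (\<top>\<^bsub>D\<^esub>) = \<top>\<^bsub>Opens X\<^esub>"
      by (rule eqI) (simp_all add: h D L frame_top_closed chi_h chi_hom(3) frame_homD(3)[OF e])
  next
    fix a b assume ab: "a \<in> carrier D" "b \<in> carrier D"
    show "h (a \<sqinter>\<^bsub>D\<^esub> b) = h a \<sqinter>\<^bsub>Opens X\<^esub> h b"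
      by (rule eqI) (simp_all add: ab h D L frame_meet_closed chi_h chi_hom(4) frame_homD(4)[OF e])
  qed (fact h)
qed

end

section \<open>Adjunctions induced by a two-valued object\<close>

text \<open>A category \<open>A\<close> with a faithful functor \<open>U\<close> to frames and an object \<open>two\<close> whose incoming arrows
  are frame maps to the two-element frame: \<open>val f a\<close> is the value of \<open>f : X \<rightarrow> two\<close> at \<open>a\<close>. An arrow
  to \<open>two\<close> is identified with the element \<open>enc f\<close> of the universe, so that such arrows can be the
  points of a space even if the arrows of \<open>A\<close> are not elements of the universe.\<close>

locale two_valued_duality = universe elts
  for elts :: "'u \<Rightarrow> 'u set" +
  fixes A :: "('o, 'm) cat" and U :: "('o, 'm, 'u gorder, ('u gorder, 'u) arrow) ftor"
    and two :: 'o and val :: "'m \<Rightarrow> 'u \<Rightarrow> 'u" and enc :: "'m \<Rightarrow> 'u"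
  assumes U: "is_functor A Frm U" and faithful_U: "faithful A U"
    and val_hom: "f \<in> Hom A X two \<Longrightarrow> frame_hom (fob U X) Two (val f)"
    and val_inject: "f \<in> Hom A X two \<Longrightarrow> g \<in> Hom A X two \<Longrightarrow>
      (\<And>a. a \<in> carrier (fob U X) \<Longrightarrow> val f a = val g a) \<Longrightarrow> f = g"
    and val_comp: "p \<in> Hom A X Y \<Longrightarrow> g \<in> Hom A Y two \<Longrightarrow> a \<in> carrier (fob U X) \<Longrightarrow>
      val (g \<circ>\<^bsub>A\<^esub> p) a = val g (fn (farr U p) a)"
    and enc_inject: "f \<in> Hom A X two \<Longrightarrow> g \<in> Hom A X two \<Longrightarrow> enc f = enc g \<Longrightarrow> f = g"
    and small_enc: "X \<in> Ob A \<Longrightarrow> small (enc ` Hom A X two)"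
begin

lemma category_A: "category A"
  using U by (simp add: is_functor_def)

lemma U_Hom:
  assumes "p \<in> Hom A X Y"
  shows "src (farr U p) = fob U X" "tgt (farr U p) = fob U Y"
    and "frame_hom (fob U X) (fob U Y) (fn (farr U p))"
    and "a \<in> carrier (fob U X) \<Longrightarrow> fn (farr U p) a \<in> carrier (fob U Y)"
  using functor_Hom[OF U assms] by (auto simp: Frm_Hom)

lemma frame_U: "X \<in> Ob A \<Longrightarrow> frame (fob U X)"
  using functor_Ob[OF U] by (auto simp: Ob_Frm)

lemma U_comp:
  assumes "p \<in> Hom A X Y" "q \<in> Hom A Y Z" "a \<in> carrier (fob U X)"
  shows "fn (farr U (q \<circ>\<^bsub>A\<^esub> p)) a = fn (farr U q) (fn (farr U p) a)"
  using assms by (simp add: functor_comp[OF U] U_Hom)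

lemma U_Id: "X \<in> Ob A \<Longrightarrow> a \<in> carrier (fob U X) \<Longrightarrow> fn (farr U (Id A X)) a = a"
  by (simp add: functor_Id[OF U])

lemma U_eqI:
  assumes f: "f \<in> Hom A X Y" and g: "g \<in> Hom A X Y"
    and "\<And>a. a \<in> carrier (fob U X) \<Longrightarrow> fn (farr U f) a = fn (farr U g) a"
  shows "f = g"
proof -
  have "farr U f = farr U g"
    by (rule Frm_eqI[OF functor_Hom[OF U f] functor_Hom[OF U g] assms(3)])
  then show ?thesis
    using faithful_U f g category_Dom_Cod[OF category_A f] by (auto simp: faithful_def dest: inj_onD)
qed

lemma val_inject':
  assumes f: "f \<in> Hom A X two" and g: "g \<in> Hom A X two"
    and "\<And>a. a \<in> carrier (fob U X) \<Longrightarrow> val f a = one \<longleftrightarrow> val g a = one"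
  shows "f = g"
proof (rule val_inject[OF f g])
  fix a assume a: "a \<in> carrier (fob U X)"
  show "val f a = val g a"
    using frame_homD(1)[OF val_hom[OF f] a] frame_homD(1)[OF val_hom[OF g] a] assms(3)[OF a]
    by (rule Two_eqI)
qed

text \<open>The basic open set given by \<open>a\<close>: the points \<open>X \<rightarrow> two\<close> with value \<open>one\<close> at \<open>a\<close>.\<close>

definition coz :: "'o \<Rightarrow> 'u \<Rightarrow> 'u set" where
  "coz X a = enc ` {f \<in> Hom A X two. val f a = one}"

text \<open>The space of points of \<open>X\<close>. The sets \<open>coz X a\<close> are already closed under unions and binary
  intersections, because the points are frame maps.\<close>

definition points :: "'o \<Rightarrow> 'u topology" where
  "points X = topology (\<lambda>V. \<exists>a\<in>carrier (fob U X). V = coz X a)"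

lemma enc_coz [simp]: "f \<in> Hom A X two \<Longrightarrow> enc f \<in> coz X a \<longleftrightarrow> val f a = one"
  using enc_inject by (auto simp: coz_def)

lemma coz_subset: "coz X a \<subseteq> enc ` Hom A X two"
  by (auto simp: coz_def)

lemma coz_eqI:
  assumes "V \<subseteq> enc ` Hom A X two" "\<And>f. f \<in> Hom A X two \<Longrightarrow> enc f \<in> V \<longleftrightarrow> val f a = one"
  shows "V = coz X a"
  using assms coz_subset[of X a] by auto

lemma openin_points:
  assumes X: "X \<in> Ob A"
  shows "openin (points X) V \<longleftrightarrow> (\<exists>a\<in>carrier (fob U X). V = coz X a)"
proof -
  have "istopology (\<lambda>V. \<exists>a\<in>carrier (fob U X). V = coz X a)" (is "istopology ?P")
    unfolding istopology_def
  proof (intro conjI allI impI)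
    fix V W assume "?P V" "?P W"
    then obtain a b where ab: "a \<in> carrier (fob U X)" "b \<in> carrier (fob U X)" "V = coz X a" "W = coz X b"
      by blast
    have "V \<inter> W = coz X (a \<sqinter>\<^bsub>fob U X\<^esub> b)"
      using ab coz_subset[of X a] by (intro coz_eqI) (auto simp: frame_hom_Two_meet[OF val_hom])
    then show "?P (V \<inter> W)" using frame_meet_closed[OF frame_U[OF X]] ab by blast
  next
    fix \<K> assume \<K>: "\<forall>V\<in>\<K>. ?P V"
    define S where "S = {a \<in> carrier (fob U X). coz X a \<in> \<K>}"
    have S: "S \<subseteq> carrier (fob U X)" by (auto simp: S_def)
    have \<K>_S: "\<K> = coz X ` S" using \<K> by (auto simp: S_def)
    have "\<Union>\<K> = coz X (\<Squnion>\<^bsub>fob U X\<^esub> S)"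
      using coz_subset[of X] by (intro coz_eqI) (auto simp: \<K>_S frame_hom_Two_sup[OF val_hom S])
    then show "?P (\<Union>\<K>)" using frame_sup_closed[OF frame_U[OF X] S] by blast
  qed
  then show ?thesis by (simp add: points_def topology_inverse')
qed

lemma topspace_points:
  assumes X: "X \<in> Ob A" shows "topspace (points X) = enc ` Hom A X two"
proof
  show "topspace (points X) \<subseteq> enc ` Hom A X two"
    using openin_points[OF X, of "topspace (points X)"] coz_subset by (metis openin_topspace)
  have "enc ` Hom A X two = coz X (\<top>\<^bsub>fob U X\<^esub>)"
    by (intro coz_eqI) (auto simp: frame_hom_Two_top[OF val_hom])
  then have "openin (points X) (enc ` Hom A X two)"
    using openin_points[OF X] frame_top_closed[OF frame_U[OF X]] by blast
  then show "enc ` Hom A X two \<subseteq> topspace (points X)" by (rule openin_subset)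
qed

lemma small_points: "X \<in> Ob A \<Longrightarrow> small (topspace (points X))"
  by (simp add: topspace_points small_enc)

lemma continuous_into_points:
  assumes Y: "Y \<in> Ob A" and f: "\<And>x. x \<in> topspace X \<Longrightarrow> f x \<in> enc ` Hom A Y two"
    and "\<And>a. a \<in> carrier (fob U Y) \<Longrightarrow> openin X {x \<in> topspace X. f x \<in> coz Y a}"
  shows "continuous_map X (points Y) f"
  using assms by (auto simp: continuous_map_def openin_points topspace_points)

end

text \<open>Candidate data for an adjunction between \<open>A\<close> and the opposite of the full subcategory of
  \<open>Top\<close> on \<open>T\<close>, with left adjoint \<open>F\<close> given by the spaces of points. The functor \<open>G\<close>, the unit
  \<open>eta\<close> and the counit \<open>eps\<close> are only described through the open sets of the spaces involved:
  \<open>th X\<close> identifies the elements of \<open>G X\<close> with the opens of \<open>X\<close>, and \<open>c X x : G X \<rightarrow> two\<close> is the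
  evaluation at the point \<open>x\<close>. As the spaces form the opposite category, \<open>eps X\<close> is a continuous
  map out of \<open>X\<close>.\<close>

locale two_valued_adjunction = two_valued_duality elts A U two val enc
  for elts :: "'u \<Rightarrow> 'u set" and A :: "('o, 'm) cat" and U and two and val and enc +
  fixes T :: "'u topology set" and th :: "'u topology \<Rightarrow> 'u \<Rightarrow> 'u"
    and c :: "'u topology \<Rightarrow> 'u \<Rightarrow> 'm"
    and F :: "('o, 'm, 'u topology, ('u topology, 'u) arrow) ftor"
    and G :: "('u topology, ('u topology, 'u) arrow, 'o, 'm) ftor"
    and eta :: "'o \<Rightarrow> 'm" and eps :: "'u topology \<Rightarrow> ('u topology, 'u) arrow"
  assumes small_T: "X \<in> T \<Longrightarrow> small (topspace X)"
    and points_T: "C \<in> Ob A \<Longrightarrow> points C \<in> T"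
    and bij_th: "X \<in> T \<Longrightarrow> bij_betw (th X) (carrier (fob U (fob G X))) (carrier (Opens X))"
    and F_ob: "C \<in> Ob A \<Longrightarrow> fob F C = points C"
    and F_arr: "p \<in> Hom A C D \<Longrightarrow> src (farr F p) = points D \<and> tgt (farr F p) = points C \<and>
      fn (farr F p) \<in> extensional (topspace (points D))"
    and F_fn: "p \<in> Hom A C D \<Longrightarrow> g \<in> Hom A D two \<Longrightarrow> fn (farr F p) (enc g) = enc (g \<circ>\<^bsub>A\<^esub> p)"
    and G_ob: "X \<in> T \<Longrightarrow> fob G X \<in> Ob A"
    and G_arr: "X \<in> T \<Longrightarrow> Y \<in> T \<Longrightarrow> f \<in> Hom Top X Y \<Longrightarrow> farr G f \<in> Hom A (fob G Y) (fob G X)"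
    and G_fn: "X \<in> T \<Longrightarrow> Y \<in> T \<Longrightarrow> f \<in> Hom Top X Y \<Longrightarrow> a \<in> carrier (fob U (fob G Y)) \<Longrightarrow>
      elts (th X (fn (farr U (farr G f)) a)) = {x \<in> topspace X. fn f x \<in> elts (th Y a)}"
    and eta_arr: "C \<in> Ob A \<Longrightarrow> eta C \<in> Hom A C (fob G (points C))"
    and eta_fn: "C \<in> Ob A \<Longrightarrow> a \<in> carrier (fob U C) \<Longrightarrow>
      elts (th (points C) (fn (farr U (eta C)) a)) = coz C a"
    and c_arr: "X \<in> T \<Longrightarrow> x \<in> topspace X \<Longrightarrow> c X x \<in> Hom A (fob G X) two"
    and c_val: "X \<in> T \<Longrightarrow> x \<in> topspace X \<Longrightarrow> a \<in> carrier (fob U (fob G X)) \<Longrightarrow>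
      val (c X x) a = one \<longleftrightarrow> x \<in> elts (th X a)"
    and eps_eq: "X \<in> T \<Longrightarrow> eps X = Arrow X (\<lambda>x\<in>topspace X. enc (c X x)) (points (fob G X))"
begin

abbreviation "TopT \<equiv> full_subcat Top T"

lemma category_TopT: "category TopT"
  by (rule category_full_subcat[OF category_Top])

lemma Ob_TopT: "Ob TopT = T"
  using small_T by (auto simp: Ob_Top)

lemma TopT_Hom: "f \<in> Hom TopT X Y \<longleftrightarrow> X \<in> T \<and> Y \<in> T \<and> f \<in> Hom Top X Y"
  by (auto simp: Hom_full_subcat)

lemma Top_Hom_fn: "f \<in> Hom Top X Y \<Longrightarrow> x \<in> topspace X \<Longrightarrow> fn f x \<in> topspace Y"
  by (auto simp: Top_Hom)

lemma Top_Hom_src: "f \<in> Hom Top X Y \<Longrightarrow> src f = X"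
  by (auto simp: Top_Hom)

lemma Hom_into_G_eqI:
  assumes X: "X \<in> T" and f: "f \<in> Hom A C (fob G X)" and g: "g \<in> Hom A C (fob G X)"
    and eq: "\<And>a. a \<in> carrier (fob U C) \<Longrightarrow>
      elts (th X (fn (farr U f) a)) = elts (th X (fn (farr U g) a))"
  shows "f = g"
proof (rule U_eqI[OF f g])
  fix a assume a: "a \<in> carrier (fob U C)"
  then have "th X (fn (farr U f) a) = th X (fn (farr U g) a)"
    using eq elts_inject by (meson injD)
  then show "fn (farr U f) a = fn (farr U g) a"
    using bij_th[OF X] U_Hom(4)[OF f a] U_Hom(4)[OF g a] by (auto simp: bij_betw_def dest: inj_onD)
qed

lemma F_Hom:
  assumes p: "p \<in> Hom A C D" shows "farr F p \<in> Hom Top (points D) (points C)"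
proof -
  have C: "C \<in> Ob A" and D: "D \<in> Ob A" using category_Dom_Cod[OF category_A p] .
  have fn: "fn (farr F p) (enc g) = enc (g \<circ>\<^bsub>A\<^esub> p)" "g \<circ>\<^bsub>A\<^esub> p \<in> Hom A C two"
    if "g \<in> Hom A D two" for g
    using F_fn[OF p that] category_comp[OF category_A p that] by auto
  have "continuous_map (points D) (points C) (fn (farr F p))"
  proof (rule continuous_into_points[OF C])
    fix a assume a: "a \<in> carrier (fob U C)"
    have "{x \<in> topspace (points D). fn (farr F p) x \<in> coz C a} = coz D (fn (farr U p) a)"
      by (rule coz_eqI) (auto simp: topspace_points[OF D] fn val_comp[OF p _ a])
    then show "openin (points D) {x \<in> topspace (points D). fn (farr F p) x \<in> coz C a}"
      using openin_points[OF D] U_Hom(4)[OF p a] by blast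
  qed (auto simp: topspace_points[OF D] fn)
  moreover have "fn (farr F p) \<in> topspace (points D) \<rightarrow>\<^sub>E topspace (points C)"
    using F_arr[OF p] fn by (auto simp: PiE_iff topspace_points C D)
  ultimately show ?thesis
    using F_arr[OF p] by (simp add: Top_Hom small_points C D)
qed

lemma points_eqI:
  assumes D: "D \<in> Ob A" and "f \<in> Hom Top (points D) Y" "g \<in> Hom Top (points D) Y"
    and "\<And>h. h \<in> Hom A D two \<Longrightarrow> fn f (enc h) = fn g (enc h)"
  shows "f = g"
  using assms(2,3) by (rule Top_eqI) (use assms(4) topspace_points[OF D] in auto)

lemma F_functor: "is_functor A (op_cat TopT) F"
proof (rule functorI)
  fix C assume C: "C \<in> Ob A"
  have Id: "Id A C \<in> Hom A C C" by (rule category_Id[OF category_A C])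
  have PId: "Id Top (points C) \<in> Hom Top (points C) (points C)"
    by (rule category_Id[OF category_Top]) (simp add: Ob_Top small_points C)
  have "farr F (Id A C) = Id Top (points C)"
    by (rule points_eqI[OF C F_Hom[OF Id] PId])
      (simp add: F_fn[OF Id] topspace_points[OF C] category_comp_Id[OF category_A])
  then show "farr F (Id A C) = Id (op_cat TopT) (fob F C)" by (simp add: F_ob[OF C])
next
  fix C D E p q assume p: "p \<in> Hom A C D" and q: "q \<in> Hom A D E"
  have E: "E \<in> Ob A" and D: "D \<in> Ob A" using category_Dom_Cod[OF category_A q] by auto
  note qp = category_comp[OF category_A p q]
  have "farr F (q \<circ>\<^bsub>A\<^esub> p) = farr F p \<circ>\<^bsub>Top\<^esub> farr F q"
  proof (rule points_eqI[OF E F_Hom[OF qp] category_comp[OF category_Top F_Hom[OF q] F_Hom[OF p]]])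
    fix h assume h: "h \<in> Hom A E two"
    have "enc h \<in> topspace (points E)" using h by (simp add: topspace_points[OF E])
    then show "fn (farr F (q \<circ>\<^bsub>A\<^esub> p)) (enc h) = fn (farr F p \<circ>\<^bsub>Top\<^esub> farr F q) (enc h)"
      using h by (simp add: F_arr[OF q] F_fn[OF q] F_fn[OF qp] F_fn[OF p category_comp[OF category_A q h]]
          category_assoc[OF category_A p q h])
  qed
  then show "farr F (q \<circ>\<^bsub>A\<^esub> p) = farr F q \<circ>\<^bsub>op_cat TopT\<^esub> farr F p" by simp
next
  fix C D p assume p: "p \<in> Hom A C D"
  then show "farr F p \<in> Hom (op_cat TopT) (fob F C) (fob F D)"
    using F_Hom[OF p] category_Dom_Cod[OF category_A p] by (simp add: TopT_Hom F_ob points_T)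
qed (use category_A category_op[OF category_TopT] Ob_TopT F_ob points_T in auto)

lemma G_functor: "is_functor (op_cat TopT) A G"
proof (rule functorI)
  fix X assume "X \<in> Ob (op_cat TopT)"
  then have X: "X \<in> T" using Ob_TopT by simp
  have Id: "Id Top X \<in> Hom Top X X"
    by (rule category_Id[OF category_Top]) (simp add: Ob_Top small_T X)
  have GX: "fob G X \<in> Ob A" by (rule G_ob[OF X])
  have "farr G (Id Top X) = Id A (fob G X)"
  proof (rule Hom_into_G_eqI[OF X G_arr[OF X X Id] category_Id[OF category_A GX]])
    fix a assume a: "a \<in> carrier (fob U (fob G X))"
    then have "th X a \<in> carrier (Opens X)" using bij_th[OF X] by (auto simp: bij_betw_def)
    then have "elts (th X a) \<subseteq> topspace X" using Opens_elts[OF small_T[OF X]] openin_subset by auto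
    then show "elts (th X (fn (farr U (farr G (Id Top X))) a)) = elts (th X (fn (farr U (Id A (fob G X))) a))"
      using a by (auto simp: G_fn[OF X X Id] U_Id[OF GX])
  qed
  then show "farr G (Id (op_cat TopT) X) = Id A (fob G X)" by simp
next
  fix X Y Z f g assume "f \<in> Hom (op_cat TopT) X Y" "g \<in> Hom (op_cat TopT) Y Z"
  then have X: "X \<in> T" and Y: "Y \<in> T" and Z: "Z \<in> T" and f: "f \<in> Hom Top Y X" and g: "g \<in> Hom Top Z Y"
    by (auto simp: TopT_Hom)
  note fg = category_comp[OF category_Top g f]
  note Gf = G_arr[OF Y X f] and Gg = G_arr[OF Z Y g]
  have "farr G (f \<circ>\<^bsub>Top\<^esub> g) = farr G g \<circ>\<^bsub>A\<^esub> farr G f"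
  proof (rule Hom_into_G_eqI[OF Z G_arr[OF Z X fg] category_comp[OF category_A Gf Gg]])
    fix a assume a: "a \<in> carrier (fob U (fob G X))"
    show "elts (th Z (fn (farr U (farr G (f \<circ>\<^bsub>Top\<^esub> g))) a)) =
        elts (th Z (fn (farr U (farr G g \<circ>\<^bsub>A\<^esub> farr G f)) a))"
      using Top_Hom_fn[OF g]
      by (auto simp: G_fn[OF Z X fg a] U_comp[OF Gf Gg a] G_fn[OF Z Y g U_Hom(4)[OF Gf a]]
          G_fn[OF Y X f a] Top_Hom_src[OF g])
  qed
  then show "farr G (g \<circ>\<^bsub>op_cat TopT\<^esub> f) = farr G g \<circ>\<^bsub>A\<^esub> farr G f" by simp
qed (use category_A category_op[OF category_TopT] Ob_TopT G_ob G_arr in \<open>auto simp: TopT_Hom\<close>)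

lemma fn_eps: "X \<in> T \<Longrightarrow> x \<in> topspace X \<Longrightarrow> fn (eps X) x = enc (c X x)"
  by (simp add: eps_eq)

lemma eps_Hom:
  assumes X: "X \<in> T" shows "eps X \<in> Hom Top X (points (fob G X))"
proof -
  note GX = G_ob[OF X]
  have "continuous_map X (points (fob G X)) (fn (eps X))"
  proof (rule continuous_into_points[OF GX])
    fix a assume a: "a \<in> carrier (fob U (fob G X))"
    then have "th X a \<in> carrier (Opens X)" using bij_th[OF X] by (auto simp: bij_betw_def)
    then have o: "openin X (elts (th X a))" using Opens_elts[OF small_T[OF X]] by simp
    have "{x \<in> topspace X. fn (eps X) x \<in> coz (fob G X) a} = elts (th X a)"
      using openin_subset[OF o] by (auto simp: fn_eps[OF X] c_val[OF X _ a] c_arr[OF X])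
    with o show "openin X {x \<in> topspace X. fn (eps X) x \<in> coz (fob G X) a}" by simp
  qed (simp add: fn_eps[OF X] c_arr[OF X])
  moreover have "fn (eps X) \<in> topspace X \<rightarrow>\<^sub>E topspace (points (fob G X))"
    by (auto simp: eps_eq[OF X] topspace_points[OF GX] c_arr[OF X])
  ultimately show ?thesis
    by (simp add: Top_Hom small_T[OF X] small_points[OF GX]) (simp add: eps_eq[OF X])
qed

lemma eta_nat: "nat_trans A A id_ftor (G \<circ>\<^sub>F F) eta"
proof (rule nat_transI)
  show "is_functor A A (G \<circ>\<^sub>F F)" by (rule functor_compose[OF F_functor G_functor])
next
  fix C assume C: "C \<in> Ob A"
  then show "eta C \<in> Hom A (fob id_ftor C) (fob (G \<circ>\<^sub>F F) C)"
    using eta_arr by (simp add: id_ftor_def comp_ftor_def F_ob)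
next
  fix C D p assume p: "p \<in> Hom A C D"
  have C: "C \<in> Ob A" and D: "D \<in> Ob A" using category_Dom_Cod[OF category_A p] .
  note FC = points_T[OF C] and FD = points_T[OF D]
  note GF = G_arr[OF FD FC F_Hom[OF p]]
  have "farr G (farr F p) \<circ>\<^bsub>A\<^esub> eta C = eta D \<circ>\<^bsub>A\<^esub> p"
  proof (rule Hom_into_G_eqI[OF FD category_comp[OF category_A eta_arr[OF C] GF]
        category_comp[OF category_A p eta_arr[OF D]]])
    fix a assume a: "a \<in> carrier (fob U C)"
    have "elts (th (points D) (fn (farr U (farr G (farr F p) \<circ>\<^bsub>A\<^esub> eta C)) a)) =
      {x \<in> topspace (points D). fn (farr F p) x \<in> coz C a}"
      by (simp add: U_comp[OF eta_arr[OF C] GF a] G_fn[OF FD FC F_Hom[OF p]] U_Hom(4)[OF eta_arr[OF C] a]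
          eta_fn[OF C a])
    also have "\<dots> = coz D (fn (farr U p) a)"
      by (rule coz_eqI) (auto simp: topspace_points[OF D] F_fn[OF p] val_comp[OF p _ a]
          category_comp[OF category_A p])
    also have "\<dots> = elts (th (points D) (fn (farr U (eta D \<circ>\<^bsub>A\<^esub> p)) a))"
      by (simp add: U_comp[OF p eta_arr[OF D] a] eta_fn[OF D U_Hom(4)[OF p a]])
    finally show "elts (th (points D) (fn (farr U (farr G (farr F p) \<circ>\<^bsub>A\<^esub> eta C)) a)) =
      elts (th (points D) (fn (farr U (eta D \<circ>\<^bsub>A\<^esub> p)) a))" .
  qed
  then show "farr (G \<circ>\<^sub>F F) p \<circ>\<^bsub>A\<^esub> eta C = eta D \<circ>\<^bsub>A\<^esub> farr id_ftor p"
    by (simp add: id_ftor_def comp_ftor_def)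
qed (rule functor_id[OF category_A])

lemma eps_nat: "nat_trans (op_cat TopT) (op_cat TopT) (F \<circ>\<^sub>F G) id_ftor eps"
proof (rule nat_transI)
  show "is_functor (op_cat TopT) (op_cat TopT) (F \<circ>\<^sub>F G)"
    by (rule functor_compose[OF G_functor F_functor])
  show "is_functor (op_cat TopT) (op_cat TopT) id_ftor"
    by (rule functor_id[OF category_op[OF category_TopT]])
next
  fix X assume "X \<in> Ob (op_cat TopT)"
  then have X: "X \<in> T" using Ob_TopT by simp
  then show "eps X \<in> Hom (op_cat TopT) (fob (F \<circ>\<^sub>F G) X) (fob id_ftor X)"
    using eps_Hom[OF X] by (simp add: id_ftor_def comp_ftor_def F_ob G_ob TopT_Hom points_T)
next
  fix X Y f assume "f \<in> Hom (op_cat TopT) X Y"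
  then have X: "X \<in> T" and Y: "Y \<in> T" and f: "f \<in> Hom Top Y X" by (auto simp: TopT_Hom)
  note Gf = G_arr[OF Y X f]
  have "eps X \<circ>\<^bsub>Top\<^esub> f = farr F (farr G f) \<circ>\<^bsub>Top\<^esub> eps Y"
  proof (rule Top_eqI[OF category_comp[OF category_Top f eps_Hom[OF X]]
        category_comp[OF category_Top eps_Hom[OF Y] F_Hom[OF Gf]]])
    fix y assume y: "y \<in> topspace Y"
    note x = Top_Hom_fn[OF f y]
    have "c X (fn f y) = c Y y \<circ>\<^bsub>A\<^esub> farr G f"
    proof (rule val_inject'[OF c_arr[OF X x] category_comp[OF category_A Gf c_arr[OF Y y]]])
      fix a assume a: "a \<in> carrier (fob U (fob G X))"
      show "val (c X (fn f y)) a = one \<longleftrightarrow> val (c Y y \<circ>\<^bsub>A\<^esub> farr G f) a = one"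
        using y by (simp add: c_val[OF X x a] val_comp[OF Gf c_arr[OF Y y] a]
            c_val[OF Y y U_Hom(4)[OF Gf a]] G_fn[OF Y X f a])
    qed
    then show "fn (eps X \<circ>\<^bsub>Top\<^esub> f) y = fn (farr F (farr G f) \<circ>\<^bsub>Top\<^esub> eps Y) y"
      using y x by (simp add: Top_Hom_src[OF f] Top_Hom_src[OF eps_Hom[OF Y]] fn_eps X Y
          F_fn[OF Gf c_arr[OF Y y]])
  qed
  then show "farr id_ftor f \<circ>\<^bsub>op_cat TopT\<^esub> eps X = eps Y \<circ>\<^bsub>op_cat TopT\<^esub> farr (F \<circ>\<^sub>F G) f"
    by (simp add: id_ftor_def comp_ftor_def)
qed

lemma triangle_F:
  assumes C: "C \<in> Ob A"
  shows "farr F (eta C) \<circ>\<^bsub>Top\<^esub> eps (points C) = Id Top (points C)"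
proof -
  note FC = points_T[OF C]
  note eC = eta_arr[OF C]
  have Id: "Id Top (points C) \<in> Hom Top (points C) (points C)"
    by (rule category_Id[OF category_Top]) (simp add: Ob_Top small_points C)
  show ?thesis
  proof (rule points_eqI[OF C category_comp[OF category_Top eps_Hom[OF FC] F_Hom[OF eC]] Id])
    fix h assume h: "h \<in> Hom A C two"
    have h': "enc h \<in> topspace (points C)" using h by (simp add: topspace_points[OF C])
    note ch = c_arr[OF FC h']
    have "c (points C) (enc h) \<circ>\<^bsub>A\<^esub> eta C = h"
    proof (rule val_inject'[OF category_comp[OF category_A eC ch] h])
      fix a assume a: "a \<in> carrier (fob U C)"
      show "val (c (points C) (enc h) \<circ>\<^bsub>A\<^esub> eta C) a = one \<longleftrightarrow> val h a = one"
        using h by (simp add: val_comp[OF eC ch a] c_val[OF FC h' U_Hom(4)[OF eC a]] eta_fn[OF C a])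
    qed
    then show "fn (farr F (eta C) \<circ>\<^bsub>Top\<^esub> eps (points C)) (enc h) = fn (Id Top (points C)) (enc h)"
      using h' by (simp add: Top_Hom_src[OF eps_Hom[OF FC]] fn_eps[OF FC] F_fn[OF eC ch])
  qed
qed

lemma triangle_G:
  assumes X: "X \<in> T"
  shows "farr G (eps X) \<circ>\<^bsub>A\<^esub> eta (fob G X) = Id A (fob G X)"
proof -
  note GX = G_ob[OF X]
  note FGX = points_T[OF GX]
  note Ge = G_arr[OF X FGX eps_Hom[OF X]] and eG = eta_arr[OF GX]
  show ?thesis
  proof (rule Hom_into_G_eqI[OF X category_comp[OF category_A eG Ge] category_Id[OF category_A GX]])
    fix a assume a: "a \<in> carrier (fob U (fob G X))"
    then have "th X a \<in> carrier (Opens X)" using bij_th[OF X] by (auto simp: bij_betw_def)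
    then have sub: "elts (th X a) \<subseteq> topspace X" using Opens_elts[OF small_T[OF X]] openin_subset by auto
    have "elts (th X (fn (farr U (farr G (eps X) \<circ>\<^bsub>A\<^esub> eta (fob G X))) a)) =
      {x \<in> topspace X. fn (eps X) x \<in> coz (fob G X) a}"
      by (simp add: U_comp[OF eG Ge a] G_fn[OF X FGX eps_Hom[OF X] U_Hom(4)[OF eG a]] eta_fn[OF GX a])
    also have "\<dots> = elts (th X a)"
      using sub by (auto simp: fn_eps[OF X] c_arr[OF X] c_val[OF X _ a])
    finally show "elts (th X (fn (farr U (farr G (eps X) \<circ>\<^bsub>A\<^esub> eta (fob G X))) a)) =
      elts (th X (fn (farr U (Id A (fob G X))) a))"
      by (simp add: U_Id[OF GX a])
  qed
qed

theorem adjunction_two_valued: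
  "adjunction \<lparr>lcat = A, rcat = op_cat TopT, ladj = F, radj = G, aunit = eta, acounit = eps\<rparr>"
  unfolding adjunction_def Let_def
  using F_functor G_functor eta_nat eps_nat triangle_F triangle_G Ob_TopT
  by (auto simp: F_ob)

end

section \<open>The classical adjunction\<close>

context universe
begin

lemma fn_PiE_Frm: "p \<in> Hom Frm L M \<Longrightarrow> a \<in> carrier L \<Longrightarrow> fn p a \<in> carrier M"
  by (auto simp: Frm_Hom)

lemma id_ftor_simps [simp]: "fob id_ftor X = X" "farr id_ftor f = f"
  by (simp_all add: id_ftor_def)

lemma classical_duality: "two_valued_duality elts Frm id_ftor Two fn graph"
proof unfold_locales
  show "is_functor Frm Frm id_ftor" by (rule functor_id[OF category_Frm])
  show "faithful Frm id_ftor" by (simp add: faithful_def inj_on_def)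
  show "fn (g \<circ>\<^bsub>Frm\<^esub> p) a = fn g (fn (farr id_ftor p) a)"
    if "p \<in> Hom Frm L M" "a \<in> carrier (fob id_ftor L)" for p g L M a
    using that by (simp add: Frm_Hom)
  show "f = g" if "f \<in> Hom Frm L Two" "g \<in> Hom Frm L Two"
    "\<And>a. a \<in> carrier (fob id_ftor L) \<Longrightarrow> fn f a = fn g a" for f g L
    using that by (intro Frm_eqI[of f L Two g]) auto
  show "frame_hom (fob id_ftor L) Two (fn f)" if "f \<in> Hom Frm L Two" for f L
    using that by (simp add: Frm_Hom)
qed (use small_graphs graph_inject in blast)+

interpretation cl: two_valued_duality elts Frm id_ftor Two fn graph
  by (rule classical_duality)

lemma cl_points: "cl.points L = pt_ob L"
  by (simp add: cl.points_def pt_ob_def cl.coz_def)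

lemmas topspace_pt_ob = cl.topspace_points[unfolded cl_points]

lemma small_vimage: "small (topspace X) \<Longrightarrow> small {x \<in> topspace X. P x}"
  by (rule small_subset) auto

lemma Omega_Hom:
  assumes f: "f \<in> Hom Top X Y"
  shows "farr Omega f \<in> Hom Frm (Opens Y) (Opens X)"
    and "a \<in> carrier (Opens Y) \<Longrightarrow> elts (fn (farr Omega f) a) = {x \<in> topspace X. fn f x \<in> elts a}"
proof -
  have X: "small (topspace X)" and Y: "small (topspace Y)" and src: "src f = X" "tgt f = Y"
    and cont: "continuous_map X Y (fn f)"
    using f by (auto simp: Top_Hom)
  let ?h = "\<lambda>a. set_of {x \<in> topspace X. fn f x \<in> elts a}"
  have h: "?h a \<in> carrier (Opens X)" if "a \<in> carrier (Opens Y)" for a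
    using that cont by (intro set_of_Opens) (simp add: Opens_elts[OF Y] continuous_map_def)
  have LY: "frame (Opens Y)" "small (carrier (Opens Y))" and LX: "frame (Opens X)" "small (carrier (Opens X))"
    using Opens_Ob X Y by (auto simp: Ob_Frm)
  have "frame_hom (Opens Y) (Opens X) ?h"
  proof (rule frame_hom_into_Opens[OF X LY(1) h])
    show "frame_hom (Opens Y) Two (chi_fun Y (fn f x))" if "x \<in> topspace X" for x
      using that cont by (intro frame_hom_chi_fun[OF Y]) (auto simp: continuous_map_def)
    show "x \<in> elts (?h a) \<longleftrightarrow> chi_fun Y (fn f x) a = one"
      if "x \<in> topspace X" "a \<in> carrier (Opens Y)" for x a
      using that by (simp add: small_vimage[OF X] chi_fun_apply)
  qed
  then have "frame_hom (Opens Y) (Opens X) (fn (farr Omega f))"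
    by (rule frame_hom_cong[OF _ LY(1)]) (simp add: Omega_def src)
  then show "farr Omega f \<in> Hom Frm (Opens Y) (Opens X)"
    unfolding Frm_Hom using LX LY h by (auto simp: Omega_def src)
  show "elts (fn (farr Omega f) a) = {x \<in> topspace X. fn f x \<in> elts a}" if "a \<in> carrier (Opens Y)"
    using that by (simp add: Omega_def src small_vimage[OF X])
qed

lemma chi_fun_Hom:
  assumes X: "small (topspace X)" and x: "x \<in> topspace X"
  shows "Arrow (Opens X) (chi_fun X x) Two \<in> Hom Frm (Opens X) Two"
  using Opens_Ob[OF X] Two_Ob frame_hom_chi_fun[OF X x]
  by (auto simp: Frm_Hom Ob_Frm chi_fun_def)

lemma pt_unit_Hom:
  assumes L: "L \<in> Ob Frm"
  shows "pt_unit L \<in> Hom Frm L (Opens (pt_ob L))"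
    and "a \<in> carrier L \<Longrightarrow> elts (fn (pt_unit L) a) = cl.coz L a"
proof -
  have small: "small (topspace (pt_ob L))"
    using cl.small_points[OF L] by (simp add: cl_points)
  have coz: "openin (pt_ob L) (cl.coz L a)" if "a \<in> carrier L" for a
    using cl.openin_points[OF L, of "cl.coz L a"] that by (auto simp: cl_points)
  have unit_eq: "fn (pt_unit L) = (\<lambda>a\<in>carrier L. set_of (cl.coz L a))"
    by (simp add: pt_unit_def cl.coz_def)
  show elts_unit: "elts (fn (pt_unit L) a) = cl.coz L a" if "a \<in> carrier L" for a
    using that small_openin[OF small coz[OF that]] by (simp add: unit_eq)
  have mem: "fn (pt_unit L) a \<in> carrier (Opens (pt_ob L))" if "a \<in> carrier L" for a
    using that coz set_of_Opens by (simp add: unit_eq)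
  have fL: "frame L" "small (carrier L)" using L by (auto simp: Ob_Frm)
  have "frame_hom L (Opens (pt_ob L)) (fn (pt_unit L))"
  proof (rule frame_hom_into_Opens[OF small fL(1) mem])
    fix u assume "u \<in> topspace (pt_ob L)"
    then obtain p where p: "p \<in> Hom Frm L Two" "u = graph p" by (auto simp: topspace_pt_ob[OF L])
    then show "frame_hom L Two (fn (of_graph L u))"
      by (simp add: of_graph_graph) (simp add: Frm_Hom)
    show "u \<in> elts (fn (pt_unit L) a) \<longleftrightarrow> fn (of_graph L u) a = one" if "a \<in> carrier L" for a
      using p by (simp add: elts_unit[OF that] of_graph_graph)
  qed
  then show "pt_unit L \<in> Hom Frm L (Opens (pt_ob L))"
    unfolding Frm_Hom using fL Opens_Ob[OF small] mem
    by (auto simp: Ob_Frm unit_eq) (auto simp: pt_unit_def)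
qed

lemma pt_fn:
  assumes "h \<in> Hom Frm L M" "p \<in> Hom Frm M Two"
  shows "fn (farr pt h) (graph p) = graph (p \<circ>\<^bsub>Frm\<^esub> h)"
proof -
  have "tgt h = M" "M \<in> Ob Frm" using assms by (auto simp: Frm_Hom Ob_Frm)
  then show ?thesis using assms by (simp add: pt_def topspace_pt_ob of_graph_graph)
qed

text \<open>For frames, \<open>U\<close> and \<open>th\<close> are identities, and frame maps \<open>L \<rightarrow> 2\<close> are coded by their graphs.\<close>

lemma classical_two_valued_adjunction:
  "two_valued_adjunction elts Frm id_ftor Two fn graph (Ob Top) (\<lambda>X a. a)
     (\<lambda>X x. Arrow (Opens X) (chi_fun X x) Two) pt Omega pt_unit pt_counit"
proof unfold_locales
  fix C D p assume p: "p \<in> Hom Frm C D"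
  show "src (farr pt p) = cl.points D \<and> tgt (farr pt p) = cl.points C \<and>
      fn (farr pt p) \<in> extensional (topspace (cl.points D))"
    using p by (auto simp: pt_def cl_points Frm_Hom)
next
  fix X Y f a assume "f \<in> Hom Top X Y" "a \<in> carrier (fob id_ftor (fob Omega Y))"
  then show "elts (fn (farr id_ftor (farr Omega f)) a) = {x \<in> topspace X. fn f x \<in> elts a}"
    using Omega_Hom(2) by (simp add: Omega_def)
next
  fix X x assume "X \<in> Ob Top" "x \<in> topspace X"
  then show "Arrow (Opens X) (chi_fun X x) Two \<in> Hom Frm (fob Omega X) Two"
    using chi_fun_Hom by (simp add: Ob_Top Omega_def)
next
  fix X x a assume "a \<in> carrier (fob id_ftor (fob Omega X))"
  then show "fn (Arrow (Opens X) (chi_fun X x) Two) a = one \<longleftrightarrow> x \<in> elts a"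
    by (simp add: Omega_def chi_fun_apply)
next
  fix X Y f assume "f \<in> Hom Top X Y"
  then show "farr Omega f \<in> Hom Frm (fob Omega Y) (fob Omega X)"
    using Omega_Hom(1)[of f X Y] by (simp add: Omega_def)
next
  fix C assume "C \<in> Ob Frm"
  then show "pt_unit C \<in> Hom Frm C (fob Omega (cl.points C))"
    using pt_unit_Hom(1)[of C] by (simp add: Omega_def cl_points)
qed (simp_all add: Ob_Top cl.small_points, simp_all add: cl_points pt_fn pt_unit_Hom Opens_Ob,
    simp_all add: pt_def Omega_def Opens_Ob pt_counit_def bij_betw_def)

interpretation cl: two_valued_adjunction elts Frm id_ftor Two fn graph "Ob Top" "\<lambda>X a. a"
  "\<lambda>X x. Arrow (Opens X) (chi_fun X x) Two" pt Omega pt_unit pt_counit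
  by (rule classical_two_valued_adjunction)

lemma full_subcat_Ob_Top: "full_subcat Top (Ob Top) = Top"
  using full_subcat_Ob[OF category_Top, of UNIV] by (simp add: full_subcat_UNIV)

theorem adjunction_classical: "adjunction classical_adj"
  using cl.adjunction_two_valued by (simp add: full_subcat_Ob_Top classical_adj_def)

lemmas functor_pt = cl.F_functor[unfolded full_subcat_Ob_Top]
lemmas functor_Omega = cl.G_functor[unfolded full_subcat_Ob_Top]

end

section \<open>The adjunction of an SFC-category\<close>

lemma (in universe) functor_und: "is_functor Frm SetC und"
proof (rule functorI[OF category_Frm category_SetC])
  fix L M f assume "f \<in> Hom Frm L M"
  then show "farr und f \<in> Hom SetC (fob und L) (fob und M)"
    by (auto simp: und_def Frm_Hom SetC_Hom)
qed (auto simp: und_def Ob_Frm Ob_SetC, auto simp: Frm_def SetC_def)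

lemma (in universe) fn_und [simp]: "fn (farr und f) = fn f"
  by (simp add: und_def)

lemma (in universe) small_inj:
  assumes "inj_on f S" "small (f ` S)" shows "small S"
  using small_image[OF assms(2), of "inv_into S f"] assms(1) by (simp add: image_image)

text \<open>An SFC-category with a choice of cartesian lifts \<open>\<theta> X\<close> on objects \<open>Om X\<close>. Its arrows are
  elements of the universe, hence serve as points without any coding.\<close>

locale sfc_lifts = universe elts
  for elts :: "'u \<Rightarrow> 'u set" +
  fixes K :: "('o, 'u) pfc" and Om :: "'u topology \<Rightarrow> 'o"
    and \<theta> :: "'u topology \<Rightarrow> ('u set, 'u) arrow"
  assumes sfc: "sfc_category K" and lift_choice: "lift_choice K Om \<theta>"
begin

abbreviation "\<C> \<equiv> Ccat K"
abbreviation "\<O> \<equiv> Ofun K"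
abbreviation "two \<equiv> two_C K"

lemma functor_O: "is_functor \<C> Frm \<O>" and faithful_O: "faithful \<C> \<O>" and two_Ob: "two \<in> Ob \<C>"
  and iota_Hom: "\<iota> K \<in> Hom Frm (fob \<O> two) Two" and iso_iota: "iso_arr Frm (\<iota> K)"
  using sfc by (auto simp: sfc_category_def pfc_category_def)

lemma category_C: "category \<C>"
  using functor_O by (simp add: is_functor_def)

lemma ptC_TopC: "X \<in> Ob \<C> \<Longrightarrow> ptC_ob K X \<in> Ob (TopC K)"
  using sfc by (auto simp: sfc_category_def)

lemma O_Hom:
  assumes "f \<in> Hom \<C> X Y"
  shows "src (farr \<O> f) = fob \<O> X" "tgt (farr \<O> f) = fob \<O> Y"
    "a \<in> carrier (fob \<O> X) \<Longrightarrow> fn (farr \<O> f) a \<in> carrier (fob \<O> Y)"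
  using functor_Hom[OF functor_O assms] by (auto simp: Frm_Hom)

lemma ev_eq: "f \<in> Hom \<C> X two \<Longrightarrow> a \<in> carrier (fob \<O> X) \<Longrightarrow> ev K f a = fn (\<iota> K) (fn (farr \<O> f) a)"
  by (simp add: ev_def O_Hom)

lemma iota_O_Hom: "f \<in> Hom \<C> X two \<Longrightarrow> \<iota> K \<circ>\<^bsub>Frm\<^esub> farr \<O> f \<in> Hom Frm (fob \<O> X) Two"
  by (rule category_comp[OF category_Frm functor_Hom[OF functor_O] iota_Hom])

lemma iota_inverse:
  shows "b \<in> carrier (fob \<O> two) \<Longrightarrow> fn (inv_arr Frm (\<iota> K)) (fn (\<iota> K) b) = b"
    and "t \<in> carrier Two \<Longrightarrow> fn (\<iota> K) (fn (inv_arr Frm (\<iota> K)) t) = t"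
    and "inv_arr Frm (\<iota> K) \<in> Hom Frm Two (fob \<O> two)"
proof -
  note inv = inverse_arrs_Hom[OF iota_Hom iso_arr_inv_arr[OF category_Frm iso_iota]]
  show J: "inv_arr Frm (\<iota> K) \<in> Hom Frm Two (fob \<O> two)" by (rule inv)
  have src: "src (\<iota> K) = fob \<O> two" "src (inv_arr Frm (\<iota> K)) = Two"
    using iota_Hom J by (auto simp: Frm_Hom)
  show "fn (inv_arr Frm (\<iota> K)) (fn (\<iota> K) b) = b" if "b \<in> carrier (fob \<O> two)"
    using fn_comp_Frm[of b "\<iota> K" "inv_arr Frm (\<iota> K)"] that inv(2) src by simp
  show "fn (\<iota> K) (fn (inv_arr Frm (\<iota> K)) t) = t" if "t \<in> carrier Two"
    using fn_comp_Frm[of t "inv_arr Frm (\<iota> K)" "\<iota> K"] that inv(3) src by simp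
qed

lemma ev_inject:
  assumes f: "f \<in> Hom \<C> X two" and g: "g \<in> Hom \<C> X two"
    and eq: "\<And>a. a \<in> carrier (fob \<O> X) \<Longrightarrow> ev K f a = ev K g a"
  shows "f = g"
proof -
  have "farr \<O> f = farr \<O> g"
  proof (rule Frm_eqI[OF functor_Hom[OF functor_O f] functor_Hom[OF functor_O g]])
    fix a assume a: "a \<in> carrier (fob \<O> X)"
    then have "fn (\<iota> K) (fn (farr \<O> f) a) = fn (\<iota> K) (fn (farr \<O> g) a)"
      using eq by (simp add: ev_eq[OF f] ev_eq[OF g])
    then show "fn (farr \<O> f) a = fn (farr \<O> g) a"
      using iota_inverse(1) O_Hom(3)[OF f a] O_Hom(3)[OF g a] by metis
  qed
  then show ?thesis
    using faithful_O f g category_Dom_Cod[OF category_C f] two_Ob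
    by (auto simp: faithful_def dest: inj_onD)
qed

lemma duality: "two_valued_duality elts \<C> \<O> two (ev K) (\<lambda>f. f)"
proof unfold_locales
  show "is_functor \<C> Frm \<O>" by (rule functor_O)
  show "faithful \<C> \<O>" by (rule faithful_O)
  show "frame_hom (fob \<O> X) Two (ev K f)" if "f \<in> Hom \<C> X two" for f X
  proof -
    have "ev K f = fn (\<iota> K \<circ>\<^bsub>Frm\<^esub> farr \<O> f)" by (simp add: ev_def fun_eq_iff)
    then show ?thesis using iota_O_Hom[OF that] by (simp add: Frm_Hom)
  qed
  show "f = g" if "f \<in> Hom \<C> X two" "g \<in> Hom \<C> X two"
    "\<And>a. a \<in> carrier (fob \<O> X) \<Longrightarrow> ev K f a = ev K g a" for f g X
    using that by (rule ev_inject)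
  show "ev K (g \<circ>\<^bsub>\<C>\<^esub> p) a = ev K g (fn (farr \<O> p) a)"
    if p: "p \<in> Hom \<C> X Y" and g: "g \<in> Hom \<C> Y two" and a: "a \<in> carrier (fob \<O> X)" for p g X Y a
    by (simp add: ev_eq[OF category_comp[OF category_C p g] a] ev_eq[OF g O_Hom(3)[OF p a]]
        functor_comp[OF functor_O p g] O_Hom(1)[OF p] a)
  \<comment> \<open>By faithfulness, \<open>\<C>(X, two)\<close> embeds into the small set of graphs of frame maps.\<close>
  show "small ((\<lambda>f. f) ` Hom \<C> X two)" if "X \<in> Ob \<C>" for X
  proof -
    let ?g = "\<lambda>f. graph (farr \<O> f)"
    have "inj_on ?g (Hom \<C> X two)"
    proof (rule inj_onI)
      fix f g assume f: "f \<in> Hom \<C> X two" and g: "g \<in> Hom \<C> X two" and "?g f = ?g g"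
      then have "farr \<O> f = farr \<O> g"
        by (intro graph_inject[OF functor_Hom[OF functor_O f] functor_Hom[OF functor_O g]])
      then show "f = g" by (intro ev_inject[OF f g]) (simp add: ev_def)
    qed
    moreover have "small (?g ` Hom \<C> X two)"
      by (rule small_subset[OF small_graphs[of "fob \<O> X" "fob \<O> two"]])
        (auto intro: functor_Hom[OF functor_O])
    ultimately show ?thesis using small_inj by simp
  qed
qed

sublocale D: two_valued_duality elts \<C> \<O> two "ev K" "\<lambda>f. f"
  by (rule duality)

lemma points_eq: "D.points X = ptC_ob K X"
  by (simp add: D.points_def ptC_ob_def D.coz_def)

lemma coz_eq: "D.coz X a = {f \<in> Hom \<C> X two. ev K f a = one}"
  by (simp add: D.coz_def)

lemma TopC_Top: "X \<in> Ob (TopC K) \<Longrightarrow> small (topspace X)"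
  by (auto simp: TopC_def Ob_Top)

lemma fob_undO [simp]: "fob (undO K) X = carrier (fob \<O> X)"
  by (simp add: undO_def comp_ftor_def und_def)

lemma fn_undO [simp]: "fn (farr (undO K) f) = fn (farr \<O> f)"
  by (simp add: undO_def comp_ftor_def)

lemma functor_undO: "is_functor \<C> SetC (undO K)"
  unfolding undO_def by (rule functor_compose[OF functor_O functor_und])

lemma undO_Hom: "f \<in> Hom \<C> X Y \<Longrightarrow> farr (undO K) f \<in> Hom SetC (carrier (fob \<O> X)) (carrier (fob \<O> Y))"
  using functor_Hom[OF functor_undO, of f X Y] by simp

lemma faithful_undO: "faithful \<C> (undO K)"
  unfolding faithful_def
proof (intro ballI inj_onI)
  fix X Y f g assume f: "f \<in> Hom \<C> X Y" and g: "g \<in> Hom \<C> X Y" and "farr (undO K) f = farr (undO K) g"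
  then have "fn (farr \<O> f) = fn (farr \<O> g)" by (metis fn_undO)
  then show "f = g" by (intro D.U_eqI[OF f g]) simp
qed

lemma cartesian:
  "X \<in> Ob (TopC K) \<Longrightarrow> cartesian_lift \<C> SetC (undO K) (carrier (Opens X)) two (topspace X)
     (eval_family K X) (Om X) (\<theta> X)"
  using lift_choice by (simp add: lift_choice_def is_eval_lift_def)

lemma Om_Ob: "X \<in> Ob (TopC K) \<Longrightarrow> Om X \<in> Ob \<C>"
  using cartesian by (simp add: cartesian_lift_def)

lemma theta_Hom: "X \<in> Ob (TopC K) \<Longrightarrow> \<theta> X \<in> Hom SetC (carrier (fob \<O> (Om X))) (carrier (Opens X))"
  using cartesian by (simp add: cartesian_lift_def)

lemma theta_mem:
  "X \<in> Ob (TopC K) \<Longrightarrow> a \<in> carrier (fob \<O> (Om X)) \<Longrightarrow> fn (\<theta> X) a \<in> carrier (Opens X)"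
  using theta_Hom[of X] by (auto simp: SetC_Hom)

lemma theta_src: "X \<in> Ob (TopC K) \<Longrightarrow> src (\<theta> X) = carrier (fob \<O> (Om X))"
  using theta_Hom by (auto simp: SetC_Hom)

lemma theta_inverse:
  assumes X: "X \<in> Ob (TopC K)"
  shows "inv_arr SetC (\<theta> X) \<in> Hom SetC (carrier (Opens X)) (carrier (fob \<O> (Om X)))"
    and "a \<in> carrier (fob \<O> (Om X)) \<Longrightarrow> fn (inv_arr SetC (\<theta> X)) (fn (\<theta> X) a) = a"
    and "b \<in> carrier (Opens X) \<Longrightarrow> fn (\<theta> X) (fn (inv_arr SetC (\<theta> X)) b) = b"
    and "b \<in> carrier (Opens X) \<Longrightarrow> fn (inv_arr SetC (\<theta> X)) b \<in> carrier (fob \<O> (Om X))"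
proof -
  have "iso_arr SetC (\<theta> X)" using cartesian[OF X] by (simp add: cartesian_lift_def)
  note inv = inverse_arrs_Hom[OF theta_Hom[OF X] iso_arr_inv_arr[OF category_SetC this]]
  show J: "inv_arr SetC (\<theta> X) \<in> Hom SetC (carrier (Opens X)) (carrier (fob \<O> (Om X)))" by (rule inv)
  then have src: "src (inv_arr SetC (\<theta> X)) = carrier (Opens X)" by (simp add: SetC_Hom)
  show "fn (inv_arr SetC (\<theta> X)) (fn (\<theta> X) a) = a" if "a \<in> carrier (fob \<O> (Om X))"
    using fn_comp_SetC[of a "\<theta> X" "inv_arr SetC (\<theta> X)"] that inv(2) theta_src[OF X] by simp
  show "fn (\<theta> X) (fn (inv_arr SetC (\<theta> X)) b) = b" if "b \<in> carrier (Opens X)"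
    using fn_comp_SetC[of b "inv_arr SetC (\<theta> X)" "\<theta> X"] that inv(3) src by simp
  show "fn (inv_arr SetC (\<theta> X)) b \<in> carrier (fob \<O> (Om X))" if "b \<in> carrier (Opens X)"
    using J that by (auto simp: SetC_Hom)
qed

lemma bij_theta: "X \<in> Ob (TopC K) \<Longrightarrow> bij_betw (fn (\<theta> X)) (carrier (fob \<O> (Om X))) (carrier (Opens X))"
  by (rule bij_betw_byWitness[of _ "fn (inv_arr SetC (\<theta> X))"])
    (auto simp: theta_inverse theta_mem)

lemma eval_family_Hom:
  assumes X: "X \<in> Ob (TopC K)"
  shows "eval_family K X x \<in> Hom SetC (carrier (Opens X)) (carrier (fob \<O> two))"
    and "a \<in> carrier (Opens X) \<Longrightarrow> fn (eval_family K X x) a = fn (inv_arr Frm (\<iota> K)) (chi_fun X x a)"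
proof -
  have chi: "chi X x \<in> Hom SetC (carrier (Opens X)) (carrier Two)"
    using Opens_Ob[OF TopC_Top[OF X]] by (auto simp: SetC_Hom chi_def Ob_Frm small_two chi_fun_def)
  have J: "farr und (inv_arr Frm (\<iota> K)) \<in> Hom SetC (carrier Two) (carrier (fob \<O> two))"
    using functor_Hom[OF functor_und iota_inverse(3)] by (simp add: und_def)
  show "eval_family K X x \<in> Hom SetC (carrier (Opens X)) (carrier (fob \<O> two))"
    unfolding eval_family_def by (rule category_comp[OF category_SetC chi J])
  show "fn (eval_family K X x) a = fn (inv_arr Frm (\<iota> K)) (chi_fun X x a)" if "a \<in> carrier (Opens X)"
    using that by (simp add: eval_family_def chi_def)
qed

text \<open>An arrow \<open>g : Y \<rightarrow> two\<close> lifts \<open>\<iota>\<inverse> \<chi>\<^sub>x \<theta>\<^sub>X h\<close> iff it takes the value \<open>one\<close> exactly where the open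
  set \<open>\<theta>\<^sub>X(h a)\<close> contains \<open>x\<close>.\<close>

lemma eval_theta_eq:
  assumes X: "X \<in> Ob (TopC K)" and g: "g \<in> Hom \<C> Y two"
    and h: "h \<in> Hom SetC (carrier (fob \<O> Y)) (carrier (fob \<O> (Om X)))"
  shows "farr (undO K) g = eval_family K X x \<circ>\<^bsub>SetC\<^esub> \<theta> X \<circ>\<^bsub>SetC\<^esub> h \<longleftrightarrow>
    (\<forall>a\<in>carrier (fob \<O> Y). ev K g a = one \<longleftrightarrow> x \<in> elts (fn (\<theta> X) (fn h a)))"
    (is "?g = ?e \<longleftrightarrow> ?R")
proof -
  have e\<theta>: "eval_family K X x \<circ>\<^bsub>SetC\<^esub> \<theta> X \<in> Hom SetC (carrier (fob \<O> (Om X))) (carrier (fob \<O> two))"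
    by (rule category_comp[OF category_SetC theta_Hom[OF X] eval_family_Hom(1)[OF X]])
  have e: "?e \<in> Hom SetC (carrier (fob \<O> Y)) (carrier (fob \<O> two))"
    by (rule category_comp[OF category_SetC h e\<theta>])
  have src: "src h = carrier (fob \<O> Y)" using h by (simp add: SetC_Hom)
  have hm: "fn h a \<in> carrier (fob \<O> (Om X))" if "a \<in> carrier (fob \<O> Y)" for a
    using h that by (auto simp: SetC_Hom)
  have fe: "fn ?e a = fn (inv_arr Frm (\<iota> K)) (chi_fun X x (fn (\<theta> X) (fn h a)))"
    if "a \<in> carrier (fob \<O> Y)" for a
    using that hm[OF that] theta_mem[OF X] by (simp add: src theta_src[OF X] eval_family_Hom(2)[OF X])
  have chi2: "chi_fun X x (fn (\<theta> X) (fn h a)) = (if x \<in> elts (fn (\<theta> X) (fn h a)) then one else zero)"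
    if "a \<in> carrier (fob \<O> Y)" for a
    using theta_mem[OF X hm[OF that]] by (rule chi_fun_apply)
  have pointwise: "fn ?g a = fn ?e a \<longleftrightarrow> (ev K g a = one \<longleftrightarrow> x \<in> elts (fn (\<theta> X) (fn h a)))"
    if a: "a \<in> carrier (fob \<O> Y)" for a
  proof -
    have chiT: "chi_fun X x (fn (\<theta> X) (fn h a)) \<in> carrier Two" using chi2[OF a] by simp
    have evT: "ev K g a \<in> carrier Two" using frame_homD(1)[OF D.val_hom[OF g] a] .
    have "fn ?g a = fn ?e a \<longleftrightarrow> ev K g a = chi_fun X x (fn (\<theta> X) (fn h a))"
      using iota_inverse(1)[OF O_Hom(3)[OF g a]] iota_inverse(2)[OF chiT]
      by (simp add: fe[OF a] ev_eq[OF g a]) metis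
    also have "\<dots> \<longleftrightarrow> (ev K g a = one \<longleftrightarrow> x \<in> elts (fn (\<theta> X) (fn h a)))"
      using evT by (auto simp: chi2[OF a])
    finally show ?thesis .
  qed
  show ?thesis
  proof
    assume ?R
    then show "?g = ?e" using pointwise by (intro SetC_eqI[OF undO_Hom[OF g] e]) blast
  next
    assume "?g = ?e"
    then show ?R using pointwise by metis
  qed
qed

text \<open>The cartesian property in terms of open sets: a function \<open>h\<close> from \<open>\<O> Y\<close> to the opens of \<open>X\<close>
  comes from an arrow \<open>Y \<rightarrow> Om X\<close> if for every point \<open>x\<close> the condition \<open>x \<in> h a\<close> is described by
  an arrow \<open>Y \<rightarrow> two\<close>.\<close>

lemma lift_into_Om:
  assumes X: "X \<in> Ob (TopC K)" and Y: "Y \<in> Ob \<C>"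
    and h: "\<And>a. a \<in> carrier (fob \<O> Y) \<Longrightarrow> h a \<in> carrier (Opens X)"
    and g: "\<And>x. x \<in> topspace X \<Longrightarrow> g x \<in> Hom \<C> Y two"
    and gh: "\<And>x a. x \<in> topspace X \<Longrightarrow> a \<in> carrier (fob \<O> Y) \<Longrightarrow> ev K (g x) a = one \<longleftrightarrow> x \<in> elts (h a)"
  obtains p where "p \<in> Hom \<C> Y (Om X)" "\<And>a. a \<in> carrier (fob \<O> Y) \<Longrightarrow> fn (\<theta> X) (fn (farr \<O> p) a) = h a"
proof -
  define h' where "h' = Arrow (carrier (fob \<O> Y)) (\<lambda>a\<in>carrier (fob \<O> Y). fn (inv_arr SetC (\<theta> X)) (h a))
    (carrier (fob \<O> (Om X)))"
  have h'a: "fn (\<theta> X) (fn h' a) = h a" if "a \<in> carrier (fob \<O> Y)" for a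
    using that h by (simp add: h'_def theta_inverse[OF X])
  have h': "h' \<in> Hom SetC (carrier (fob \<O> Y)) (carrier (fob \<O> (Om X)))"
    using h functor_Ob[OF functor_O Y] functor_Ob[OF functor_O Om_Ob[OF X]]
    by (auto simp: h'_def SetC_Hom Ob_Frm theta_inverse[OF X])
  have "lifts \<C> (undO K) Y two (eval_family K X x \<circ>\<^bsub>SetC\<^esub> \<theta> X \<circ>\<^bsub>SetC\<^esub> h')" if x: "x \<in> topspace X" for x
    using eval_theta_eq[OF X g[OF x] h', of x] g[OF x] gh[OF x]
    by (auto simp: lifts_def is_lift_def h'a)
  then have "lifts \<C> (undO K) Y (Om X) h'"
    using cartesian[OF X] Y h' by (simp add: cartesian_lift_def)
  then obtain p where p: "p \<in> Hom \<C> Y (Om X)" "farr (undO K) p = h'"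
    by (auto simp: lifts_def is_lift_def)
  have "fn (farr \<O> p) = fn h'" using p(2) fn_undO by metis
  with p(1) h'a show thesis by (intro that[of p]) auto
qed

text \<open>Since the identity of \<open>Om X\<close> lifts, so do the evaluations.\<close>

lemma chi_bar:
  assumes X: "X \<in> Ob (TopC K)" and x: "x \<in> topspace X"
  shows "chi_bar K Om \<theta> X x \<in> Hom \<C> (Om X) two"
    and "a \<in> carrier (fob \<O> (Om X)) \<Longrightarrow> ev K (chi_bar K Om \<theta> X x) a = one \<longleftrightarrow> x \<in> elts (fn (\<theta> X) a)"
proof -
  let ?I = "Id SetC (carrier (fob \<O> (Om X)))"
  note Om = Om_Ob[OF X]
  have I: "?I \<in> Hom SetC (carrier (fob \<O> (Om X))) (carrier (fob \<O> (Om X)))"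
    using functor_Ob[OF functor_undO Om] by (intro category_Id[OF category_SetC]) simp
  have "farr (undO K) (Id \<C> (Om X)) = ?I" using functor_Id[OF functor_undO Om] by simp
  then have "lifts \<C> (undO K) (Om X) (Om X) ?I"
    using category_Id[OF category_C Om] by (auto simp: lifts_def is_lift_def)
  then have "lifts \<C> (undO K) (Om X) two (eval_family K X x \<circ>\<^bsub>SetC\<^esub> \<theta> X \<circ>\<^bsub>SetC\<^esub> ?I)"
    using cartesian[OF X] Om I x by (simp add: cartesian_lift_def)
  then obtain p where p: "p \<in> Hom \<C> (Om X) two"
    and p_eq: "farr (undO K) p = eval_family K X x \<circ>\<^bsub>SetC\<^esub> \<theta> X \<circ>\<^bsub>SetC\<^esub> ?I"
    by (auto simp: lifts_def is_lift_def)
  have "eval_family K X x \<circ>\<^bsub>SetC\<^esub> \<theta> X \<circ>\<^bsub>SetC\<^esub> ?I = eval_family K X x \<circ>\<^bsub>SetC\<^esub> \<theta> X"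
    by (rule category_comp_Id(1)[OF category_SetC
          category_comp[OF category_SetC theta_Hom[OF X] eval_family_Hom(1)[OF X]]])
  then have "chi_bar K Om \<theta> X x = p"
    unfolding chi_bar_def using p p_eq by (intro the_lift_eq[OF faithful_undO Om two_Ob]) simp_all
  then show "chi_bar K Om \<theta> X x \<in> Hom \<C> (Om X) two"
    "a \<in> carrier (fob \<O> (Om X)) \<Longrightarrow> ev K (chi_bar K Om \<theta> X x) a = one \<longleftrightarrow> x \<in> elts (fn (\<theta> X) a)"
    using p eval_theta_eq[OF X p I, of x] p_eq by simp_all
qed

lemma OmegaC_arr:
  assumes X: "X \<in> Ob (TopC K)" and Y: "Y \<in> Ob (TopC K)" and f: "f \<in> Hom Top X Y"
  shows "farr (OmegaC K Om \<theta>) f \<in> Hom \<C> (Om Y) (Om X)"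
    and "a \<in> carrier (fob \<O> (Om Y)) \<Longrightarrow>
      fn (\<theta> X) (fn (farr \<O> (farr (OmegaC K Om \<theta>) f)) a) = fn (farr Omega f) (fn (\<theta> Y) a)"
proof -
  have src: "src f = X" "tgt f = Y" and fX: "\<And>x. x \<in> topspace X \<Longrightarrow> fn f x \<in> topspace Y"
    using f by (auto simp: Top_Hom)
  let ?h = "\<lambda>a. fn (farr Omega f) (fn (\<theta> Y) a)"
  obtain p where p: "p \<in> Hom \<C> (Om Y) (Om X)"
    and p_eq: "\<And>a. a \<in> carrier (fob \<O> (Om Y)) \<Longrightarrow> fn (\<theta> X) (fn (farr \<O> p) a) = ?h a"
  proof (rule lift_into_Om[OF X Om_Ob[OF Y], of ?h "\<lambda>x. chi_bar K Om \<theta> Y (fn f x)"])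
    fix a assume a: "a \<in> carrier (fob \<O> (Om Y))"
    note \<theta>a = theta_mem[OF Y a]
    show "?h a \<in> carrier (Opens X)" using fn_PiE_Frm[OF Omega_Hom(1)[OF f] \<theta>a] .
    fix x assume "x \<in> topspace X"
    then show "ev K (chi_bar K Om \<theta> Y (fn f x)) a = one \<longleftrightarrow> x \<in> elts (?h a)"
      using chi_bar(2)[OF Y fX a] by (simp add: Omega_Hom(2)[OF f \<theta>a])
  qed (use chi_bar(1)[OF Y fX] in auto)
  let ?k = "inv_arr SetC (\<theta> X) \<circ>\<^bsub>SetC\<^esub> farr und (farr Omega f) \<circ>\<^bsub>SetC\<^esub> \<theta> Y"
  have und: "farr und (farr Omega f) \<in> Hom SetC (carrier (Opens Y)) (carrier (Opens X))"
    using functor_Hom[OF functor_und Omega_Hom(1)[OF f]] by (simp add: und_def)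
  have k: "?k \<in> Hom SetC (carrier (fob \<O> (Om Y))) (carrier (fob \<O> (Om X)))"
    by (rule category_comp[OF category_SetC theta_Hom[OF Y]
          category_comp[OF category_SetC und theta_inverse(1)[OF X]]])
  have "farr (undO K) p = ?k"
  proof (rule SetC_eqI[OF undO_Hom[OF p] k])
    fix a assume a: "a \<in> carrier (fob \<O> (Om Y))"
    have "src (farr und (farr Omega f)) = carrier (Opens Y)" using und by (simp add: SetC_Hom)
    then have "fn ?k a = fn (inv_arr SetC (\<theta> X)) (?h a)"
      using a theta_mem[OF Y a] by (simp add: theta_src[OF Y])
    also have "\<dots> = fn (farr \<O> p) a"
      using theta_inverse(2)[OF X O_Hom(3)[OF p a]] by (simp add: p_eq[OF a])
    finally show "fn (farr (undO K) p) a = fn ?k a" by simp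
  qed
  then have "farr (OmegaC K Om \<theta>) f = p"
    using p by (simp add: OmegaC_def src the_lift_eq[OF faithful_undO Om_Ob[OF Y] Om_Ob[OF X]])
  then show "farr (OmegaC K Om \<theta>) f \<in> Hom \<C> (Om Y) (Om X)"
    "a \<in> carrier (fob \<O> (Om Y)) \<Longrightarrow>
      fn (\<theta> X) (fn (farr \<O> (farr (OmegaC K Om \<theta>) f)) a) = fn (farr Omega f) (fn (\<theta> Y) a)"
    using p p_eq by simp_all
qed

lemma etaC:
  assumes Y: "Y \<in> Ob \<C>"
  shows "etaC K Om \<theta> Y \<in> Hom \<C> Y (Om (ptC_ob K Y))"
    and "a \<in> carrier (fob \<O> Y) \<Longrightarrow>
      elts (fn (\<theta> (ptC_ob K Y)) (fn (farr \<O> (etaC K Om \<theta> Y)) a)) = D.coz Y a"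
proof -
  let ?P = "ptC_ob K Y"
  note P = ptC_TopC[OF Y]
  note small = TopC_Top[OF P]
  have coz: "openin ?P (D.coz Y a)" if "a \<in> carrier (fob \<O> Y)" for a
    using D.openin_points[OF Y, of "D.coz Y a"] that by (auto simp: points_eq)
  note small_coz = small_openin[OF small coz]
  have topP: "topspace ?P = Hom \<C> Y two" using D.topspace_points[OF Y] by (simp add: points_eq)
  obtain p where p: "p \<in> Hom \<C> Y (Om ?P)"
    and p_eq: "\<And>a. a \<in> carrier (fob \<O> Y) \<Longrightarrow> fn (\<theta> ?P) (fn (farr \<O> p) a) = set_of (D.coz Y a)"
    by (rule lift_into_Om[OF P Y, of "\<lambda>a. set_of (D.coz Y a)" "\<lambda>f. f"])
      (auto simp: topP small_coz intro: set_of_Opens[OF coz])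
  have "etaC K Om \<theta> Y = p"
    unfolding etaC_def
  proof (rule the_equality)
    have "fn (\<theta> ?P \<circ>\<^bsub>SetC\<^esub> farr (undO K) q) a = fn (\<theta> ?P) (fn (farr \<O> q) a)"
      if "q \<in> Hom \<C> Y (Om ?P)" "a \<in> carrier (fob \<O> Y)" for q a
      using undO_Hom[OF that(1)] that(2) by (simp add: SetC_Hom)
    note comp = this
    show "p \<in> Hom \<C> Y (Om ?P) \<and> (\<forall>a\<in>carrier (fob \<O> Y). fn (\<theta> ?P \<circ>\<^bsub>SetC\<^esub> farr (undO K) p) a =
        set_of {f \<in> Hom \<C> Y two. ev K f a = one})"
      using p p_eq comp by (simp add: coz_eq)
    fix q assume q: "q \<in> Hom \<C> Y (Om ?P) \<and> (\<forall>a\<in>carrier (fob \<O> Y). fn (\<theta> ?P \<circ>\<^bsub>SetC\<^esub> farr (undO K) q) a =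
        set_of {f \<in> Hom \<C> Y two. ev K f a = one})"
    show "q = p"
    proof (rule D.U_eqI[OF _ p])
      fix a assume a: "a \<in> carrier (fob \<O> Y)"
      have "fn (\<theta> ?P) (fn (farr \<O> q) a) = fn (\<theta> ?P) (fn (farr \<O> p) a)"
        using q a comp[of q a] p_eq[OF a] by (simp add: coz_eq)
      then show "fn (farr \<O> q) a = fn (farr \<O> p) a"
        using theta_inverse(2)[OF P O_Hom(3)[OF p a]] theta_inverse(2)[OF P O_Hom(3)[of q Y "Om ?P", OF _ a]] q
        by metis
    qed (use q in blast)
  qed
  then show "etaC K Om \<theta> Y \<in> Hom \<C> Y (Om ?P)"
    "a \<in> carrier (fob \<O> Y) \<Longrightarrow> elts (fn (\<theta> ?P) (fn (farr \<O> (etaC K Om \<theta> Y)) a)) = D.coz Y a"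
    using p p_eq small_coz by simp_all
qed

lemma ptC_fn:
  assumes p: "p \<in> Hom \<C> X Y"
  shows "src (farr (ptC K) p) = ptC_ob K Y" "tgt (farr (ptC K) p) = ptC_ob K X"
    and "fn (farr (ptC K) p) \<in> extensional (topspace (ptC_ob K Y))"
    and "g \<in> Hom \<C> Y two \<Longrightarrow> fn (farr (ptC K) p) g = g \<circ>\<^bsub>\<C>\<^esub> p"
proof -
  have dc: "Dom \<C> p = X" "Cod \<C> p = Y" "Y \<in> Ob \<C>"
    using p category_Dom_Cod[OF category_C p] by (auto simp: Hom_def)
  show "src (farr (ptC K) p) = ptC_ob K Y" "tgt (farr (ptC K) p) = ptC_ob K X"
    "fn (farr (ptC K) p) \<in> extensional (topspace (ptC_ob K Y))"
    by (simp_all add: ptC_def dc)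
  show "fn (farr (ptC K) p) g = g \<circ>\<^bsub>\<C>\<^esub> p" if "g \<in> Hom \<C> Y two"
    using that D.topspace_points[OF dc(3)] by (simp add: ptC_def dc points_eq)
qed

lemma fob_adj [simp]: "fob (ptC K) Y = ptC_ob K Y" "fob (OmegaC K Om \<theta>) X = Om X"
  by (simp_all add: ptC_def OmegaC_def)

lemma adjunction_locale:
  "two_valued_adjunction elts \<C> \<O> two (ev K) (\<lambda>f. f) (Ob (TopC K)) (\<lambda>X. fn (\<theta> X))
     (chi_bar K Om \<theta>) (ptC K) (OmegaC K Om \<theta>) (etaC K Om \<theta>) (sigmaC K Om \<theta>)"
proof unfold_locales
  fix X Y f a
  assume X: "X \<in> Ob (TopC K)" and Y: "Y \<in> Ob (TopC K)" and f: "f \<in> Hom Top X Y"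
    and a: "a \<in> carrier (fob \<O> (fob (OmegaC K Om \<theta>) Y))"
  then show "elts (fn (\<theta> X) (fn (farr \<O> (farr (OmegaC K Om \<theta>) f)) a)) =
      {x \<in> topspace X. fn f x \<in> elts (fn (\<theta> Y) a)}"
    by (simp add: OmegaC_arr(2)[OF X Y f] Omega_Hom(2)[OF f] theta_mem[OF Y])
qed (simp_all add: TopC_Top points_eq ptC_TopC bij_theta ptC_fn Om_Ob OmegaC_arr etaC chi_bar,
    simp add: sigmaC_def)

sublocale J: two_valued_adjunction elts \<C> \<O> two "ev K" "\<lambda>f. f" "Ob (TopC K)" "\<lambda>X. fn (\<theta> X)"
  "chi_bar K Om \<theta>" "ptC K" "OmegaC K Om \<theta>" "etaC K Om \<theta>" "sigmaC K Om \<theta>"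
  by (rule adjunction_locale)

lemma full_subcat_TopC: "full_subcat Top (Ob (TopC K)) = TopC K"
  unfolding TopC_def using full_subcat_Ob[OF category_Top] by simp

theorem adjunction_sfc: "adjunction (sfc_adj K Om \<theta>)"
  using J.adjunction_two_valued by (simp add: full_subcat_TopC sfc_adj_def)

lemmas functor_ptC = J.F_functor[unfolded full_subcat_TopC]
lemmas functor_OmegaC = J.G_functor[unfolded full_subcat_TopC]

end

section \<open>The right adjunction morphism\<close>

context sfc_lifts
begin

interpretation cl: two_valued_adjunction elts Frm id_ftor Two fn graph "Ob Top" "\<lambda>X a. a"
  "\<lambda>X x. Arrow (Opens X) (chi_fun X x) Two" pt Omega pt_unit pt_counit
  by (rule classical_two_valued_adjunction)

abbreviation "\<zeta> \<equiv> zeta K Om \<theta>"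
abbreviation "\<xi> \<equiv> xi K"

text \<open>The function \<open>\<theta>\<^sub>X\<close> is only assumed bijective. Its composites with the evaluations are the frame
  maps underlying the arrows \<open>chi_bar\<close>, which makes it a frame map.\<close>

lemma zeta_iso:
  assumes X: "X \<in> Ob (TopC K)"
  shows "\<zeta> X \<in> Hom Frm (fob \<O> (Om X)) (Opens X)" and "iso_arr Frm (\<zeta> X)"
proof -
  let ?L = "fob \<O> (Om X)" and ?J = "fn (inv_arr SetC (\<theta> X))"
  note small = TopC_Top[OF X]
  have L: "frame ?L" "small (carrier ?L)" and M: "frame (Opens X)" "small (carrier (Opens X))"
    using functor_Ob[OF functor_O Om_Ob[OF X]] Opens_Ob[OF small] by (auto simp: Ob_Frm)
  have hom: "frame_hom ?L (Opens X) (fn (\<theta> X))"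
  proof (rule frame_hom_into_Opens[OF small L(1) theta_mem[OF X]])
    show "frame_hom ?L Two (ev K (chi_bar K Om \<theta> X x))" if "x \<in> topspace X" for x
      by (rule D.val_hom[OF chi_bar(1)[OF X that]])
    show "x \<in> elts (fn (\<theta> X) a) \<longleftrightarrow> ev K (chi_bar K Om \<theta> X x) a = one"
      if "x \<in> topspace X" "a \<in> carrier ?L" for x a
      by (rule chi_bar(2)[OF X that, symmetric])
  qed
  then show \<zeta>: "\<zeta> X \<in> Hom Frm ?L (Opens X)"
    using theta_Hom[OF X] L M by (simp add: zeta_def Frm_Hom SetC_Hom)
  define g where "g = Arrow (Opens X) ?J ?L"
  have "frame_hom (Opens X) ?L ?J"
    by (rule frame_hom_inverse[OF hom L(1) bij_theta[OF X] theta_inverse(2)[OF X]])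
  then have g: "g \<in> Hom Frm (Opens X) ?L"
    using theta_inverse(1)[OF X] L M by (simp add: g_def Frm_Hom SetC_Hom)
  have fns: "fn (\<zeta> X) = fn (\<theta> X)" "fn g = ?J" "src (\<zeta> X) = ?L" "tgt (\<zeta> X) = Opens X" "src g = Opens X"
    by (simp_all add: zeta_def g_def)
  have "g \<circ>\<^bsub>Frm\<^esub> \<zeta> X = Id Frm ?L"
    by (rule Frm_eqI[OF category_comp[OF category_Frm \<zeta> g] category_Id[OF category_Frm]])
      (simp_all add: Ob_Frm L fns theta_inverse[OF X])
  moreover have "\<zeta> X \<circ>\<^bsub>Frm\<^esub> g = Id Frm (Opens X)"
    by (rule Frm_eqI[OF category_comp[OF category_Frm g \<zeta>] category_Id[OF category_Frm]])
      (simp_all add: Ob_Frm M fns theta_inverse[OF X])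
  ultimately have "inverse_arrs Frm (\<zeta> X) g"
    using \<zeta> g by (simp add: inverse_arrs_def Hom_def)
  then show "iso_arr Frm (\<zeta> X)" unfolding iso_arr_def by (rule exI)
qed

lemma fn_zeta: "fn (\<zeta> X) = fn (\<theta> X)"
  by (simp add: zeta_def)

lemma functor_inclusion: "is_functor (op_cat (TopC K)) (op_cat Top) id_ftor"
proof (rule functorI)
  show "category (op_cat (TopC K))"
    unfolding TopC_def by (intro category_op category_full_subcat category_Top)
  show "category (op_cat Top)" by (intro category_op category_Top)
qed (auto simp: TopC_def Hom_full_subcat split: if_splits)

lemma TopC_Hom: "f \<in> Hom (TopC K) X Y \<Longrightarrow> X \<in> Ob (TopC K) \<and> Y \<in> Ob (TopC K) \<and> f \<in> Hom Top X Y"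
  using J.TopT_Hom[of f X Y] by (simp add: full_subcat_TopC)

lemma zeta_natural:
  "nat_trans (op_cat (TopC K)) Frm (\<O> \<circ>\<^sub>F OmegaC K Om \<theta>) (Omega \<circ>\<^sub>F id_ftor) \<zeta>"
proof (rule nat_transI)
  show "is_functor (op_cat (TopC K)) Frm (\<O> \<circ>\<^sub>F OmegaC K Om \<theta>)"
    by (rule functor_compose[OF functor_OmegaC functor_O])
  show "is_functor (op_cat (TopC K)) Frm (Omega \<circ>\<^sub>F id_ftor)"
    by (rule functor_compose[OF functor_inclusion functor_Omega])
next
  fix X assume "X \<in> Ob (op_cat (TopC K))"
  then show "\<zeta> X \<in> Hom Frm (fob (\<O> \<circ>\<^sub>F OmegaC K Om \<theta>) X) (fob (Omega \<circ>\<^sub>F id_ftor) X)"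
    using zeta_iso(1)[of X] by (simp add: comp_ftor_def Omega_def)
next
  fix X Y f assume "f \<in> Hom (op_cat (TopC K)) X Y"
  then have X: "X \<in> Ob (TopC K)" and Y: "Y \<in> Ob (TopC K)" and f: "f \<in> Hom Top Y X"
    using TopC_Hom[of f Y X] by auto
  note Gf = OmegaC_arr[OF Y X f]
  note OGf = functor_Hom[OF functor_O Gf(1)]
  have "farr Omega f \<circ>\<^bsub>Frm\<^esub> \<zeta> X = \<zeta> Y \<circ>\<^bsub>Frm\<^esub> farr \<O> (farr (OmegaC K Om \<theta>) f)"
    by (rule Frm_eqI[OF category_comp[OF category_Frm zeta_iso(1)[OF X] Omega_Hom(1)[OF f]]
          category_comp[OF category_Frm OGf zeta_iso(1)[OF Y]]])
      (simp add: fn_zeta Gf(2) O_Hom(1)[OF Gf(1)], simp add: zeta_def Gf(2))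
  then show "farr (Omega \<circ>\<^sub>F id_ftor) f \<circ>\<^bsub>Frm\<^esub> \<zeta> X = \<zeta> Y \<circ>\<^bsub>Frm\<^esub> farr (\<O> \<circ>\<^sub>F OmegaC K Om \<theta>) f"
    by (simp add: comp_ftor_def)
qed

lemma topspace_ptC_ob: "X \<in> Ob \<C> \<Longrightarrow> topspace (ptC_ob K X) = Hom \<C> X two"
  using D.topspace_points[of X] by (simp add: points_eq)

lemma fn_xi: "f \<in> Hom \<C> X two \<Longrightarrow> fn (\<xi> X) f = graph (\<iota> K \<circ>\<^bsub>Frm\<^esub> farr \<O> f)"
  by (simp add: xi_def)

lemma xi_Hom:
  assumes X: "X \<in> Ob \<C>"
  shows "\<xi> X \<in> Hom Top (ptC_ob K X) (pt_ob (fob \<O> X))"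
proof -
  let ?L = "fob \<O> X"
  have L: "?L \<in> Ob Frm" by (rule functor_Ob[OF functor_O X])
  have "continuous_map (ptC_ob K X) (cl.points ?L) (fn (\<xi> X))"
  proof (rule cl.continuous_into_points[OF L])
    fix f assume "f \<in> topspace (ptC_ob K X)"
    then show "fn (\<xi> X) f \<in> graph ` Hom Frm ?L Two"
      by (simp add: topspace_ptC_ob[OF X] fn_xi iota_O_Hom)
  next
    fix a assume "a \<in> carrier (fob id_ftor ?L)"
    then have a: "a \<in> carrier ?L" by simp
    have "{f \<in> topspace (ptC_ob K X). fn (\<xi> X) f \<in> cl.coz ?L a} = D.coz X a"
      by (auto simp: topspace_ptC_ob[OF X] fn_xi iota_O_Hom coz_eq ev_def)
    then show "openin (ptC_ob K X) {f \<in> topspace (ptC_ob K X). fn (\<xi> X) f \<in> cl.coz ?L a}"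
      using D.openin_points[OF X] a by (auto simp: points_eq)
  qed
  moreover have "fn (\<xi> X) \<in> Hom \<C> X two \<rightarrow>\<^sub>E graph ` Hom Frm ?L Two"
    by (auto simp: xi_def iota_O_Hom)
  ultimately show ?thesis
    using cl.small_points[OF L] TopC_Top[OF ptC_TopC[OF X]] topspace_pt_ob[OF L]
    by (simp add: Top_Hom cl_points topspace_ptC_ob[OF X]) (simp add: xi_def)
qed

lemma pt_Hom: "h \<in> Hom Frm L M \<Longrightarrow> farr pt h \<in> Hom Top (pt_ob M) (pt_ob L)"
  using cl.F_Hom[of h L M] by (simp add: cl_points)

lemma ptC_Hom: "p \<in> Hom \<C> X Y \<Longrightarrow> farr (ptC K) p \<in> Hom Top (ptC_ob K Y) (ptC_ob K X)"
  using J.F_Hom[of p X Y] by (simp add: points_eq)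

lemma xi_natural: "nat_trans \<C> (op_cat Top) (pt \<circ>\<^sub>F \<O>) (id_ftor \<circ>\<^sub>F ptC K) \<xi>"
proof (rule nat_transI)
  show "is_functor \<C> (op_cat Top) (pt \<circ>\<^sub>F \<O>)"
    by (rule functor_compose[OF functor_O functor_pt])
  show "is_functor \<C> (op_cat Top) (id_ftor \<circ>\<^sub>F ptC K)"
    by (rule functor_compose[OF functor_ptC functor_inclusion])
next
  fix X assume "X \<in> Ob \<C>"
  then show "\<xi> X \<in> Hom (op_cat Top) (fob (pt \<circ>\<^sub>F \<O>) X) (fob (id_ftor \<circ>\<^sub>F ptC K) X)"
    using xi_Hom[of X] by (simp add: comp_ftor_def pt_def)
next
  fix X Y p assume p: "p \<in> Hom \<C> X Y"
  have X: "X \<in> Ob \<C>" and Y: "Y \<in> Ob \<C>" using category_Dom_Cod[OF category_C p] .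
  note Op = functor_Hom[OF functor_O p]
  have "\<xi> X \<circ>\<^bsub>Top\<^esub> farr (ptC K) p = farr pt (farr \<O> p) \<circ>\<^bsub>Top\<^esub> \<xi> Y"
  proof (rule Top_eqI[OF category_comp[OF category_Top ptC_Hom[OF p] xi_Hom[OF X]]
        category_comp[OF category_Top xi_Hom[OF Y] pt_Hom[OF Op]]])
    fix g assume g': "g \<in> topspace (ptC_ob K Y)"
    then have g: "g \<in> Hom \<C> Y two" by (simp add: topspace_ptC_ob[OF Y])
    have "\<iota> K \<circ>\<^bsub>Frm\<^esub> farr \<O> (g \<circ>\<^bsub>\<C>\<^esub> p) = (\<iota> K \<circ>\<^bsub>Frm\<^esub> farr \<O> g) \<circ>\<^bsub>Frm\<^esub> farr \<O> p"
      unfolding functor_comp[OF functor_O p g]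
      by (rule category_assoc[OF category_Frm Op functor_Hom[OF functor_O g] iota_Hom])
    moreover have "src (\<xi> Y) = ptC_ob K Y" by (simp add: xi_def)
    ultimately show "fn (\<xi> X \<circ>\<^bsub>Top\<^esub> farr (ptC K) p) g = fn (farr pt (farr \<O> p) \<circ>\<^bsub>Top\<^esub> \<xi> Y) g"
      using g' by (simp add: ptC_fn[OF p] g fn_xi category_comp[OF category_C p g]
          pt_fn[OF Op iota_O_Hom[OF g]])
  qed
  then show "farr (id_ftor \<circ>\<^sub>F ptC K) p \<circ>\<^bsub>op_cat Top\<^esub> \<xi> X = \<xi> Y \<circ>\<^bsub>op_cat Top\<^esub> farr (pt \<circ>\<^sub>F \<O>) p"
    by (simp add: comp_ftor_def)
qed

text \<open>The mate formula, written in \<open>Top\<close>: the order of composition is the reverse of that in the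
  opposite category, so the counit is applied first.\<close>

lemma mate_equation:
  assumes X: "X \<in> Ob \<C>"
  shows "\<xi> X = farr pt (farr \<O> (etaC K Om \<theta> X)) \<circ>\<^bsub>Top\<^esub>
    (farr pt (\<zeta> (ptC_ob K X)) \<circ>\<^bsub>Top\<^esub> pt_counit (ptC_ob K X))"
proof -
  let ?P = "ptC_ob K X"
  note P = ptC_TopC[OF X] and small = TopC_Top[OF ptC_TopC[OF X]]
  note \<zeta> = zeta_iso(1)[OF P] and e = etaC(1)[OF X]
  note Oe = functor_Hom[OF functor_O e]
  have PT: "?P \<in> Ob Top" using small by (simp add: Ob_Top)
  have \<delta>: "pt_counit ?P \<in> Hom Top ?P (pt_ob (Opens ?P))"
    using cl.eps_Hom[OF PT] by (simp add: cl_points Omega_def)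
  note \<zeta>\<delta> = category_comp[OF category_Top \<delta> pt_Hom[OF \<zeta>]]
  show ?thesis
  proof (rule Top_eqI[OF xi_Hom[OF X] category_comp[OF category_Top \<zeta>\<delta> pt_Hom[OF Oe]]])
    fix f assume f': "f \<in> topspace ?P"
    then have f: "f \<in> Hom \<C> X two" by (simp add: topspace_ptC_ob[OF X])
    let ?chi = "Arrow (Opens ?P) (chi_fun ?P f) Two"
    note chi = chi_fun_Hom[OF small f']
    note chi\<zeta> = category_comp[OF category_Frm \<zeta> chi]
    have "(?chi \<circ>\<^bsub>Frm\<^esub> \<zeta> ?P) \<circ>\<^bsub>Frm\<^esub> farr \<O> (etaC K Om \<theta> X) = \<iota> K \<circ>\<^bsub>Frm\<^esub> farr \<O> f"
    proof (rule Frm_eqI[OF category_comp[OF category_Frm Oe chi\<zeta>] iota_O_Hom[OF f]])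
      fix a assume a: "a \<in> carrier (fob \<O> X)"
      let ?b = "fn (farr \<O> (etaC K Om \<theta> X)) a"
      have b: "?b \<in> carrier (fob \<O> (Om ?P))" by (rule O_Hom(3)[OF e a])
      have "src (\<zeta> ?P) = fob \<O> (Om ?P)" by (simp add: zeta_def)
      then have "fn ((?chi \<circ>\<^bsub>Frm\<^esub> \<zeta> ?P) \<circ>\<^bsub>Frm\<^esub> farr \<O> (etaC K Om \<theta> X)) a = chi_fun ?P f (fn (\<theta> ?P) ?b)"
        using a b by (simp add: O_Hom(1)[OF e] fn_zeta)
      also have "\<dots> = (if ev K f a = one then one else zero)"
        using theta_mem[OF P b] f by (simp add: chi_fun_apply etaC(2)[OF X a] coz_eq)
      also have "\<dots> = ev K f a"
        using frame_homD(1)[OF D.val_hom[OF f] a] by auto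
      finally show "fn ((?chi \<circ>\<^bsub>Frm\<^esub> \<zeta> ?P) \<circ>\<^bsub>Frm\<^esub> farr \<O> (etaC K Om \<theta> X)) a = fn (\<iota> K \<circ>\<^bsub>Frm\<^esub> farr \<O> f) a"
        by (simp add: ev_def)
    qed
    moreover have "fn (pt_counit ?P) f = graph ?chi"
      using f' by (simp add: pt_counit_def)
    ultimately show "fn (\<xi> X) f = fn (farr pt (farr \<O> (etaC K Om \<theta> X)) \<circ>\<^bsub>Top\<^esub>
        (farr pt (\<zeta> ?P) \<circ>\<^bsub>Top\<^esub> pt_counit ?P)) f"
      using f' by (simp add: cl.Top_Hom_src[OF \<zeta>\<delta>] cl.Top_Hom_src[OF \<delta>] fn_xi[OF f]
          pt_fn[OF \<zeta> chi] pt_fn[OF Oe chi\<zeta>])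
  qed
qed

theorem right_adjunction_morphism_sfc:
  "right_adjunction_morphism (sfc_adj K Om \<theta>) classical_adj \<O> id_ftor \<zeta> \<xi>"
  unfolding right_adjunction_morphism_def mate_pair_def Let_def
  using adjunction_sfc adjunction_classical functor_O functor_inclusion zeta_natural xi_natural
    mate_equation zeta_iso(2)
  by (simp add: sfc_adj_def classical_adj_def)

end

theorem proposition2p4:
  fixes elts :: "'u \<Rightarrow> 'u set"
    and K :: "('o, 'u) pfc"
    and Om :: "'u topology \<Rightarrow> 'o"
    and \<theta> :: "'u topology \<Rightarrow> ('u set, 'u) arrow"
  assumes "universe elts"
    and "universe.sfc_category elts K"
    and "universe.lift_choice elts K Om \<theta>"
  shows "right_adjunction_morphism
           (universe.sfc_adj elts K Om \<theta>) (universe.classical_adj elts)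
           (Ofun K) id_ftor (universe.zeta elts K Om \<theta>) (universe.xi elts K)"
proof -
  interpret sfc_lifts elts K Om \<theta>
    using assms by (simp add: sfc_lifts_def sfc_lifts_axioms_def)
  show ?thesis by (rule right_adjunction_morphism_sfc)
qed

end
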